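(* Let $R$ be a left Artinian ring. The following are equivalent: (1) $\mathrm{soc}^{\ast}({}_R R)$ embeds, as a left $R$-module, into ${}_R(R/\mathrm{rad}\,R)$; (2) $R$ admits a finitarily left torsion-free homomorphism into $\mathbb{Q}/\mathbb{Z}$; (3) $R$ admits a finitarily left torsion-free character.
   Context: Rings are unital (not necessarily commutative). $\mathrm{rad}\,R$ is the Jacobson radical of $R$. The finitary left socle $\mathrm{soc}^{\ast}({}_R R)$ is the sum of all minimal left ideals of $R$ that are finite as sets. A module embeds into another if there is an injective module homomorphism. For an abelian group $E$, a homomorphism $\chi\colon R\to E$ (of the additive group of $R$ into $E$) is finitarily left torsion-free if the subgroup $\ker\chi$ contains no nonzero finite left ideal of $R$. A character on $R$ is a group homomorphism from the (discrete) additive group of $R$ into the circle group $\mathbb{T}=\{z\in\mathbb{C}: |z|=1\}$. *)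

theory Defs
  imports Complex_Main "HOL-Algebra.Algebra"
begin

section \<open>Left ideals, left Artinian rings, Jacobson radical, finitary left socle\<close>

locale left_ideal = additive_subgroup I R + ring R for I and R (structure) +
  assumes l_closed: "\<lbrakk>a \<in> I; x \<in> carrier R\<rbrakk> \<Longrightarrow> x \<otimes> a \<in> I"

locale maximal_left_ideal = left_ideal +
  assumes not_carrier: "I \<noteq> carrier R"
    and maximal: "\<lbrakk>left_ideal J R; I \<subseteq> J\<rbrakk> \<Longrightarrow> J = I \<or> J = carrier R"

locale minimal_left_ideal = left_ideal +
  assumes not_zero: "I \<noteq> {\<zero>}"
    and minimal: "\<lbrakk>left_ideal J R; J \<subseteq> I\<rbrakk> \<Longrightarrow> J = {\<zero>} \<or> J = I"

locale left_artinian_ring = ring R for R (structure) +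
  assumes descending_chain_condition:
    "\<lbrakk>\<And>n::nat. left_ideal (L n) R; decseq L\<rbrakk> \<Longrightarrow> \<exists>N. \<forall>n\<ge>N. L n = L N"

text \<open>
  The zero ring has no maximal left ideals; intersecting with the carrier makes its
  radical the whole ring.
\<close>
definition jacobson_radical :: "('a, 'b) ring_scheme \<Rightarrow> 'a set"
  where "jacobson_radical R = carrier R \<inter> \<Inter>{M. maximal_left_ideal M R}"

text \<open>
  The sum of a family of left ideals is the additive subgroup generated by their union;
  it is \<open>{\<zero>}\<close> for the empty family.
\<close>
definition finitary_left_socle :: "('a, 'b) ring_scheme \<Rightarrow> 'a set"
  where "finitary_left_socle R =
    generate (add_monoid R) (\<Union>{I. minimal_left_ideal I R \<and> finite I})"

lemma (in ring) left_ideal_jacobson_radical: "left_ideal (jacobson_radical R) R"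
proof (intro left_ideal.intro additive_subgroup.intro left_ideal_axioms.intro ring_axioms)
  have "subgroup (\<Inter>(insert (carrier R) {M. maximal_left_ideal M R})) (add_monoid R)"
    using add.subgroup_self
    by (intro add.subgroups_Inter)
      (auto dest: maximal_left_ideal.axioms(1) left_ideal.axioms(1) additive_subgroup.a_subgroup)
  then show "subgroup (jacobson_radical R) (add_monoid R)"
    by (simp add: jacobson_radical_def)
qed (auto simp: jacobson_radical_def dest: maximal_left_ideal.axioms(1) left_ideal.l_closed)

lemma (in ring) left_ideal_finitary_left_socle: "left_ideal (finitary_left_socle R) R"
proof -
  let ?U = "\<Union>{I. minimal_left_ideal I R \<and> finite I}"
  have sub: "?U \<subseteq> carrier R"
    by (auto dest!: minimal_left_ideal.axioms(1) left_ideal.axioms(1) additive_subgroup.a_subset)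
  have mult: "x \<otimes> a \<in> ?U" if "a \<in> ?U" "x \<in> carrier R" for a x
    using that by (auto dest: minimal_left_ideal.axioms(1) left_ideal.l_closed)
  have gen: "x \<otimes> a \<in> generate (add_monoid R) ?U"
    if x: "x \<in> carrier R" and a: "a \<in> generate (add_monoid R) ?U" for a x
    using a
  proof induction
    case one
    then show ?case
      using x generate.one[of "add_monoid R" ?U] by simp
  next
    case (incl h)
    then show ?case
      using mult x by (blast intro: generate.incl)
  next
    case (inv h)
    then have "x \<otimes> (\<ominus> h) = \<ominus> (x \<otimes> h)"
      using x sub r_minus by blast
    then show ?case
      using generate.inv[of "x \<otimes> h" ?U "add_monoid R"] mult x inv by (simp add: a_inv_def)
  next
    case (eng g h)
    then have "g \<in> carrier R" "h \<in> carrier R"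
      using add.generate_in_carrier[OF sub] by auto
    then show ?case
      using eng x generate.eng[of "x \<otimes> g" "add_monoid R" ?U "x \<otimes> h"] by (simp add: r_distr)
  qed
  show ?thesis
    unfolding finitary_left_socle_def
    by (intro left_ideal.intro additive_subgroup.intro left_ideal_axioms.intro ring_axioms
        add.generate_is_subgroup sub gen)
qed

section \<open>Left modules\<close>

text \<open>
  The library's locale for modules requires a commutative ring of scalars.  Its
  record type is reused here; the \<open>mult\<close> and \<open>one\<close> fields of a module play no role.
\<close>
locale left_module = R?: ring R + M?: abelian_group M
  for R :: "('r, 'm) ring_scheme" (structure)
    and M :: "('r, 'a, 'p) module_scheme" (structure) +
  assumes smult_closed:
      "\<lbrakk>a \<in> carrier R; x \<in> carrier M\<rbrakk> \<Longrightarrow> a \<odot>\<^bsub>M\<^esub> x \<in> carrier M"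
    and smult_l_distr:
      "\<lbrakk>a \<in> carrier R; b \<in> carrier R; x \<in> carrier M\<rbrakk> \<Longrightarrow>
        (a \<oplus>\<^bsub>R\<^esub> b) \<odot>\<^bsub>M\<^esub> x = a \<odot>\<^bsub>M\<^esub> x \<oplus>\<^bsub>M\<^esub> b \<odot>\<^bsub>M\<^esub> x"
    and smult_r_distr:
      "\<lbrakk>a \<in> carrier R; x \<in> carrier M; y \<in> carrier M\<rbrakk> \<Longrightarrow>
        a \<odot>\<^bsub>M\<^esub> (x \<oplus>\<^bsub>M\<^esub> y) = a \<odot>\<^bsub>M\<^esub> x \<oplus>\<^bsub>M\<^esub> a \<odot>\<^bsub>M\<^esub> y"
    and smult_assoc:
      "\<lbrakk>a \<in> carrier R; b \<in> carrier R; x \<in> carrier M\<rbrakk> \<Longrightarrow>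
        (a \<otimes>\<^bsub>R\<^esub> b) \<odot>\<^bsub>M\<^esub> x = a \<odot>\<^bsub>M\<^esub> (b \<odot>\<^bsub>M\<^esub> x)"
    and smult_one: "x \<in> carrier M \<Longrightarrow> \<one>\<^bsub>R\<^esub> \<odot>\<^bsub>M\<^esub> x = x"

definition left_module_hom ::
    "('r, 'm) ring_scheme \<Rightarrow> ('r, 'a, 'p) module_scheme \<Rightarrow> ('r, 'b, 'q) module_scheme \<Rightarrow> ('a \<Rightarrow> 'b) set"
  where "left_module_hom R M N =
    {f \<in> hom (add_monoid M) (add_monoid N).
       \<forall>r\<in>carrier R. \<forall>x\<in>carrier M. f (r \<odot>\<^bsub>M\<^esub> x) = r \<odot>\<^bsub>N\<^esub> f x}"

definition left_module_embeds ::
    "('r, 'm) ring_scheme \<Rightarrow> ('r, 'a, 'p) module_scheme \<Rightarrow> ('r, 'b, 'q) module_scheme \<Rightarrow> bool"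
  where "left_module_embeds R M N \<longleftrightarrow> (\<exists>f\<in>left_module_hom R M N. inj_on f (carrier M))"

definition left_ideal_module :: "('a, 'b) ring_scheme \<Rightarrow> 'a set \<Rightarrow> ('a, 'a) module"
  where "left_ideal_module R I =
    \<lparr>carrier = I, monoid.mult = monoid.mult R, one = \<one>\<^bsub>R\<^esub>, ring.zero = \<zero>\<^bsub>R\<^esub>, add = add R,
     smult = monoid.mult R\<rparr>"

text \<open>
  The left \<open>R\<close>-module \<open>R/J\<close> for a left ideal \<open>J\<close>, with the additive structure of
  \<open>R Quot J\<close>; the scalar action is \<open>r \<odot> (J + x) = J + r \<otimes> x\<close>.
\<close>
definition left_quotient_module :: "('a, 'b) ring_scheme \<Rightarrow> 'a set \<Rightarrow> ('a, 'a set) module"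
  where "left_quotient_module R J =
    \<lparr>carrier = a_rcosets\<^bsub>R\<^esub> J, monoid.mult = rcoset_mult R J, one = J +>\<^bsub>R\<^esub> \<one>\<^bsub>R\<^esub>,
     ring.zero = J, add = set_add R,
     smult = (\<lambda>r C. \<Union>x\<in>C. J +>\<^bsub>R\<^esub> (r \<otimes>\<^bsub>R\<^esub> x))\<rparr>"

lemma (in left_ideal) left_module_left_ideal: "left_module R (left_ideal_module R I)"
proof -
  have mem: "x \<in> carrier R" if "x \<in> I" for x
    using that a_subset by blast
  have "\<exists>y\<in>I. y \<oplus> x = \<zero>" if "x \<in> I" for x
    using that by (intro bexI[of _ "\<ominus> x"]) (simp_all add: l_neg mem)
  then have "abelian_group (left_ideal_module R I)"
    by (intro abelian_groupI)
      (simp_all add: left_ideal_module_def mem a_assoc, simp add: a_comm mem)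
  then show ?thesis
    by (intro left_module.intro left_module_axioms.intro ring_axioms)
      (simp_all add: left_ideal_module_def l_closed mem l_distr r_distr m_assoc)
qed

lemma (in left_ideal) left_quotient_smult:
  assumes r: "r \<in> carrier R" and x: "x \<in> carrier R"
  shows "r \<odot>\<^bsub>left_quotient_module R I\<^esub> (I +> x) = I +> (r \<otimes> x)"
proof -
  interpret abelian_subgroup I R
    using a_subgroup abelian_group_axioms add.m_comm
    by (intro abelian_subgroupI3 additive_subgroup.intro) auto
  have "I +> (r \<otimes> y) = I +> (r \<otimes> x)" if y: "y \<in> I +> x" for y
  proof -
    obtain i where i: "i \<in> I" "y = i \<oplus> x"
      using y by (auto simp: a_r_coset_def r_coset_def)
    have "i \<in> carrier R"
      using i a_Hcarr by blast
    then have "r \<otimes> y = (r \<otimes> i) \<oplus> (r \<otimes> x)"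
      using i r x by (simp add: r_distr)
    then have "r \<otimes> y \<in> I +> (r \<otimes> x)"
      using l_closed i r by (auto simp: a_r_coset_def r_coset_def)
    then show ?thesis
      by (rule a_repr_independence[OF _ m_closed[OF r x] a_subgroup, symmetric])
  qed
  moreover have "x \<in> I +> x"
    using a_rcos_self x by blast
  ultimately have "(\<Union>y\<in>I +> x. I +> (r \<otimes> y)) = I +> (r \<otimes> x)"
    by blast
  then show ?thesis
    by (simp add: left_quotient_module_def)
qed

lemma (in left_ideal) left_module_left_quotient: "left_module R (left_quotient_module R I)"
proof -
  interpret abelian_subgroup I R
    using a_subgroup abelian_group_axioms add.m_comm
    by (intro abelian_subgroupI3 additive_subgroup.intro) auto
  let ?Q = "left_quotient_module R I"
  have Q: "carrier ?Q = a_rcosets I" "\<zero>\<^bsub>?Q\<^esub> = I" "add ?Q = set_add R"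
    by (simp_all add: left_quotient_module_def)
  have sum: "(I +> x) \<oplus>\<^bsub>?Q\<^esub> (I +> y) = I +> (x \<oplus> y)"
    if "x \<in> carrier R" "y \<in> carrier R" for x y
    using a_rcos_sum that by (simp add: Q)
  have ex: "\<exists>x\<in>carrier R. C = I +> x" if "C \<in> carrier ?Q" for C
    using that by (auto simp: Q A_RCOSETS_def RCOSETS_def a_r_coset_def)
  have cl: "I +> x \<in> carrier ?Q" if "x \<in> carrier R" for x
    using that by (auto simp: Q A_RCOSETS_def RCOSETS_def a_r_coset_def)
  have zero: "\<zero>\<^bsub>?Q\<^esub> = I +> \<zero>"
    using a_subset by (simp add: Q a_coset_add_zero)
  have ab: "abelian_group ?Q"
  proof (intro abelian_groupI)
    show "\<exists>y\<in>carrier ?Q. y \<oplus>\<^bsub>?Q\<^esub> C = \<zero>\<^bsub>?Q\<^esub>" if C: "C \<in> carrier ?Q" for C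
    proof -
      obtain x where "x \<in> carrier R" "C = I +> x"
        using ex[OF C] by blast
      then show ?thesis
        by (intro bexI[of _ "I +> (\<ominus> x)"]) (simp_all add: sum zero cl l_neg)
    qed
  next
    show "C \<oplus>\<^bsub>?Q\<^esub> D = D \<oplus>\<^bsub>?Q\<^esub> C" if C: "C \<in> carrier ?Q" and D: "D \<in> carrier ?Q" for C D
      using ex[OF C] ex[OF D] by (elim bexE) (simp add: sum a_comm)
  next
    show "(C \<oplus>\<^bsub>?Q\<^esub> D) \<oplus>\<^bsub>?Q\<^esub> E = C \<oplus>\<^bsub>?Q\<^esub> (D \<oplus>\<^bsub>?Q\<^esub> E)"
      if C: "C \<in> carrier ?Q" and D: "D \<in> carrier ?Q" and E: "E \<in> carrier ?Q" for C D E
      using ex[OF C] ex[OF D] ex[OF E] by (elim bexE) (simp add: sum a_assoc)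
  next
    show "\<zero>\<^bsub>?Q\<^esub> \<oplus>\<^bsub>?Q\<^esub> C = C" if C: "C \<in> carrier ?Q" for C
      using ex[OF C] by (elim bexE) (simp add: sum zero)
  next
    show "C \<oplus>\<^bsub>?Q\<^esub> D \<in> carrier ?Q" if C: "C \<in> carrier ?Q" and D: "D \<in> carrier ?Q" for C D
      using ex[OF C] ex[OF D] by (elim bexE) (simp add: sum cl)
  qed (simp add: zero cl)
  show ?thesis
  proof (intro left_module.intro left_module_axioms.intro ring_axioms ab)
    fix a b C D
    assume a: "a \<in> carrier R" and C: "C \<in> carrier ?Q"
    show "a \<odot>\<^bsub>?Q\<^esub> C \<in> carrier ?Q"
      using ex[OF C] a by (elim bexE) (simp add: left_quotient_smult cl)
    show "a \<odot>\<^bsub>?Q\<^esub> (C \<oplus>\<^bsub>?Q\<^esub> D) = a \<odot>\<^bsub>?Q\<^esub> C \<oplus>\<^bsub>?Q\<^esub> a \<odot>\<^bsub>?Q\<^esub> D"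
      if D: "D \<in> carrier ?Q"
      using ex[OF C] ex[OF D] a by (elim bexE) (simp add: left_quotient_smult sum r_distr)
    assume b: "b \<in> carrier R"
    show "(a \<oplus> b) \<odot>\<^bsub>?Q\<^esub> C = a \<odot>\<^bsub>?Q\<^esub> C \<oplus>\<^bsub>?Q\<^esub> b \<odot>\<^bsub>?Q\<^esub> C"
      using ex[OF C] a b by (elim bexE) (simp add: left_quotient_smult sum l_distr)
    show "(a \<otimes> b) \<odot>\<^bsub>?Q\<^esub> C = a \<odot>\<^bsub>?Q\<^esub> (b \<odot>\<^bsub>?Q\<^esub> C)"
      using ex[OF C] a b by (elim bexE) (simp add: left_quotient_smult m_assoc)
  next
    fix C
    assume C: "C \<in> carrier ?Q"
    show "\<one> \<odot>\<^bsub>?Q\<^esub> C = C"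
      using ex[OF C] by (elim bexE) (simp add: left_quotient_smult)
  qed
qed


section \<open>Characters and finitarily left torsion-free homomorphisms\<close>

definition rat_mod_int :: "rat set monoid"
  where "rat_mod_int = \<lparr>carrier = (UNIV :: rat set), monoid.mult = (+), one = 0\<rparr> Mod \<int>"

definition circle_group :: "complex monoid"
  where "circle_group = \<lparr>carrier = {z. cmod z = 1}, monoid.mult = (*), one = 1\<rparr>"

lemma comm_group_rat_mod_int: "comm_group rat_mod_int"
proof -
  let ?Q = "\<lparr>carrier = (UNIV :: rat set), monoid.mult = (+), one = 0\<rparr>"
  have Q: "comm_group ?Q"
  proof (rule comm_groupI)
    show "\<exists>y\<in>carrier ?Q. y \<otimes>\<^bsub>?Q\<^esub> x = \<one>\<^bsub>?Q\<^esub>" for x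
      by (rule bexI[of _ "- x"]) simp_all
  qed simp_all
  then interpret comm_group ?Q .
  have inv: "inv\<^bsub>?Q\<^esub> x = - x" for x
    by (rule inv_equality) auto
  have "subgroup \<int> ?Q"
    by (rule subgroup.intro) (auto simp: inv)
  then show ?thesis
    unfolding rat_mod_int_def by (rule abelian_FactGroup)
qed

lemma comm_group_circle_group: "comm_group circle_group"
proof (rule comm_groupI)
  show "\<exists>y\<in>carrier circle_group. y \<otimes>\<^bsub>circle_group\<^esub> x = \<one>\<^bsub>circle_group\<^esub>"
    if "x \<in> carrier circle_group" for x
    using that by (intro bexI[of _ "inverse x"], cases "x = 0") (auto simp: circle_group_def norm_inverse)
qed (simp_all add: circle_group_def norm_mult)

definition characters :: "('a, 'b) ring_scheme \<Rightarrow> ('a \<Rightarrow> complex) set"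
  where "characters R = hom (add_monoid R) circle_group"

definition finitarily_left_torsion_free ::
    "('a, 'b) ring_scheme \<Rightarrow> ('e, 'c) monoid_scheme \<Rightarrow> ('a \<Rightarrow> 'e) \<Rightarrow> bool"
  where "finitarily_left_torsion_free R E \<chi> \<longleftrightarrow>
    \<not> (\<exists>I. left_ideal I R \<and> finite I \<and> I \<noteq> {\<zero>\<^bsub>R\<^esub>} \<and> I \<subseteq> kernel (add_monoid R) E \<chi>)"

end

theory Submission
  imports Defs
begin

text \<open>
  The finitary left socle \<open>S\<close> is finite and is reached by finitely many direct sums
  \<open>A + M\<close> with \<open>M\<close> a minimal left ideal.  Since left ideals above the radical have complements,
  \<open>S\<close> embeds into \<open>R / rad R\<close> iff \<open>S\<close> is cyclic.  A generator \<open>a\<close> of \<open>A\<close> extends to a generator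
  \<open>a + m\<close> of \<open>A + M\<close> unless \<open>m = h(a)\<close> for a homomorphism \<open>h: A \<rightarrow> M\<close>, so this is possible iff
  \<open>|Hom(A, M)| < |M|\<close>.  A character of \<open>A\<close> whose kernel contains no nonzero left ideal extends to
  one of \<open>A + M\<close> unless the prescribed character on \<open>M\<close> comes from a homomorphism \<open>M \<rightarrow> A\<close>, so this
  is possible iff \<open>|Hom(M, A)|\<close> is less than the number of characters of \<open>M\<close>, which is \<open>|M|\<close>.  As
  \<open>|Hom(A, M)| = |Hom(M, A)|\<close> for semisimple \<open>A\<close>, the two conditions agree by induction.  Characters
  of the finite group \<open>S\<close> take values in the roots of unity, hence lift to \<open>\<rat>/\<int>\<close>, and extend to
  \<open>R\<close> because \<open>\<rat>/\<int>\<close> is divisible.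
\<close>

section \<open>Extending homomorphisms of abelian groups\<close>

text \<open>Let a finite minimal left ideal \<open>M\<close> have q endomorphisms and q^n elements.
  It then occurs n times in \<open>R / rad R\<close>, so \<open>S\<close> embeds there iff no such
  \<open>M\<close> occurs in \<open>S\<close> more often than its own n. If \<open>M\<close> occurs
  k times in \<open>A\<close>, both Hom sets have q^k elements, and comparing them with
  \<open>|M|\<close> asks whether k < n, that is, whether there is room for one more copy. In this
  way the counts encode the multiplicities of the semisimple decomposition, while the argument
  handles one new summand at a time. Counting can decide the existence of a good \<open>m\<close>,
  or of a good character, because the bad choices are in each case the image of the Hom set under an
  injection. On finite sets a strict inequality of cardinals is then the same as the existence of a
  choice outside that image. The equality of the two Hom counts is the bridge between a condition on
  modules and one on characters.\<close>

text \<open>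
  A homomorphism from a subgroup of \<open>G\<close> to \<open>E\<close>, represented by its graph: unions of chains
  are then again of this form, as needed for Zorn's lemma.
\<close>
definition partial_hom :: "('a, 'c) monoid_scheme \<Rightarrow> ('e, 'd) monoid_scheme \<Rightarrow> ('a \<times> 'e) set \<Rightarrow> bool"
  where "partial_hom G E F \<longleftrightarrow> subgroup F (G \<times>\<times> E) \<and> (\<forall>e. (\<one>\<^bsub>G\<^esub>, e) \<in> F \<longrightarrow> e = \<one>\<^bsub>E\<^esub>)"

locale comm_group_pair = G?: comm_group G + E: comm_group E
  for G :: "('a, 'c) monoid_scheme" (structure) and E :: "('e, 'd) monoid_scheme" (structure)
begin

sublocale GE: group "G \<times>\<times> E"
  by (rule DirProd_group) unfold_locales

lemma partial_homD:
  assumes "partial_hom G E F"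
  shows "(a, e) \<in> F \<Longrightarrow> a \<in> carrier G" "(a, e) \<in> F \<Longrightarrow> e \<in> carrier E"
    "(\<one>\<^bsub>G\<^esub>, \<one>\<^bsub>E\<^esub>) \<in> F"
    "(a, e) \<in> F \<Longrightarrow> (b, d) \<in> F \<Longrightarrow> (a \<otimes>\<^bsub>G\<^esub> b, e \<otimes>\<^bsub>E\<^esub> d) \<in> F"
    "(a, e) \<in> F \<Longrightarrow> (inv\<^bsub>G\<^esub> a, inv\<^bsub>E\<^esub> e) \<in> F"
    "(a, e) \<in> F \<Longrightarrow> (a, d) \<in> F \<Longrightarrow> e = d"
proof -
  have sub: "subgroup F (G \<times>\<times> E)" and one: "\<And>e. (\<one>\<^bsub>G\<^esub>, e) \<in> F \<Longrightarrow> e = \<one>\<^bsub>E\<^esub>"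
    using assms by (auto simp: partial_hom_def)
  show aG: "(a, e) \<in> F \<Longrightarrow> a \<in> carrier G" and eE: "(a, e) \<in> F \<Longrightarrow> e \<in> carrier E" for a e
    using subgroup.subset[OF sub] by auto
  show "(\<one>\<^bsub>G\<^esub>, \<one>\<^bsub>E\<^esub>) \<in> F"
    using subgroup.one_closed[OF sub] by simp
  show mult: "(a, e) \<in> F \<Longrightarrow> (b, d) \<in> F \<Longrightarrow> (a \<otimes>\<^bsub>G\<^esub> b, e \<otimes>\<^bsub>E\<^esub> d) \<in> F" for a b e d
    using subgroup.m_closed[OF sub, of "(a, e)" "(b, d)"] by simp
  show inv: "(a, e) \<in> F \<Longrightarrow> (inv\<^bsub>G\<^esub> a, inv\<^bsub>E\<^esub> e) \<in> F" for a e
    using subgroup.m_inv_closed[OF sub, of "(a, e)"] aG eE by simp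
  assume F: "(a, e) \<in> F" "(a, d) \<in> F"
  have "e \<otimes>\<^bsub>E\<^esub> inv\<^bsub>E\<^esub> d = \<one>\<^bsub>E\<^esub>"
    using mult[OF F(1) inv[OF F(2)]] one aG[OF F(1)] by simp
  then show "e = d"
    using E.inv_solve_right'[of "\<one>\<^bsub>E\<^esub>" e d] eE F by simp
qed

lemma partial_hom_graph:
  assumes A: "subgroup A G" and f: "f \<in> hom (G\<lparr>carrier := A\<rparr>) E"
  shows "partial_hom G E ((\<lambda>a. (a, f a)) ` A)"
proof -
  interpret A: subgroup A G by fact
  have mult: "f (a \<otimes>\<^bsub>G\<^esub> b) = f a \<otimes>\<^bsub>E\<^esub> f b" and cl: "f a \<in> carrier E" if "a \<in> A" "b \<in> A" for a b
    using f that by (auto simp: hom_def)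
  have one: "f \<one>\<^bsub>G\<^esub> = \<one>\<^bsub>E\<^esub>"
    using mult[of "\<one>\<^bsub>G\<^esub>" "\<one>\<^bsub>G\<^esub>"] cl[OF A.one_closed A.one_closed] E.l_cancel_one[of "f \<one>\<^bsub>G\<^esub>" "f \<one>\<^bsub>G\<^esub>"]
    by (simp add: eq_commute)
  have inv: "f (inv\<^bsub>G\<^esub> a) = inv\<^bsub>E\<^esub> (f a)" if "a \<in> A" for a
    using that mult[of "inv\<^bsub>G\<^esub> a" a] cl one A.mem_carrier E.inv_equality[of "f (inv\<^bsub>G\<^esub> a)" "f a"] by simp
  have "subgroup ((\<lambda>a. (a, f a)) ` A) (G \<times>\<times> E)"
  proof (rule GE.subgroupI)
    show "(\<lambda>a. (a, f a)) ` A \<subseteq> carrier (G \<times>\<times> E)"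
      using cl A.mem_carrier by auto
    show "(\<lambda>a. (a, f a)) ` A \<noteq> {}"
      using A.one_closed by blast
    fix p assume "p \<in> (\<lambda>a. (a, f a)) ` A"
    then obtain a where a: "a \<in> A" "p = (a, f a)" by blast
    then have "inv\<^bsub>G \<times>\<times> E\<^esub> p = (inv\<^bsub>G\<^esub> a, f (inv\<^bsub>G\<^esub> a))"
      using inv cl A.mem_carrier by simp
    then show "inv\<^bsub>G \<times>\<times> E\<^esub> p \<in> (\<lambda>a. (a, f a)) ` A"
      using a by blast
    fix q assume "q \<in> (\<lambda>a. (a, f a)) ` A"
    then obtain b where b: "b \<in> A" "q = (b, f b)" by blast
    then have "p \<otimes>\<^bsub>G \<times>\<times> E\<^esub> q = (a \<otimes>\<^bsub>G\<^esub> b, f (a \<otimes>\<^bsub>G\<^esub> b))"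
      using a mult by simp
    then show "p \<otimes>\<^bsub>G \<times>\<times> E\<^esub> q \<in> (\<lambda>a. (a, f a)) ` A"
      using a b by blast
  qed
  then show ?thesis
    using one by (auto simp: partial_hom_def)
qed

lemma partial_hom_function:
  assumes F: "partial_hom G E F"
  obtains f where "subgroup (Domain F) G" "f \<in> hom (G\<lparr>carrier := Domain F\<rparr>) E"
    "\<And>a e. (a, e) \<in> F \<Longrightarrow> f a = e"
proof -
  define f where "f a = (THE e. (a, e) \<in> F)" for a
  have f: "f a = e" if "(a, e) \<in> F" for a e
    unfolding f_def using that partial_homD(6)[OF F] by blast
  have "subgroup (Domain F) G"
  proof (rule G.subgroupI)
    show "Domain F \<subseteq> carrier G" "Domain F \<noteq> {}"
      using partial_homD(1,3)[OF F] by auto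
  qed (use partial_homD(4,5)[OF F] in \<open>blast+\<close>)
  moreover have "f \<in> hom (G\<lparr>carrier := Domain F\<rparr>) E"
  proof (rule homI)
    show "f x \<in> carrier E" if "x \<in> carrier (G\<lparr>carrier := Domain F\<rparr>)" for x
      using that f partial_homD(2)[OF F] by auto
    show "f (x \<otimes>\<^bsub>G\<lparr>carrier := Domain F\<rparr>\<^esub> y) = f x \<otimes>\<^bsub>E\<^esub> f y"
      if "x \<in> carrier (G\<lparr>carrier := Domain F\<rparr>)" "y \<in> carrier (G\<lparr>carrier := Domain F\<rparr>)" for x y
      using that f partial_homD(4)[OF F] by auto
  qed
  ultimately show ?thesis
    using f that by blast
qed

text \<open>\<open>compat\<close> keeps the larger graph single-valued. If \<open>a\<close> times
  \<open>x [^] n\<close> is the unit, then \<open>x [^] n\<close> is the inverse of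
  \<open>a\<close>, so it already lies in the domain of \<open>F\<close>, where its value is forced
  to be the power of \<open>z\<close>.\<close>

lemma partial_hom_adjoin:
  assumes F: "partial_hom G E F" and x: "x \<in> carrier G" and z: "z \<in> carrier E"
    and compat: "\<And>(n::int) e. (x [^]\<^bsub>G\<^esub> n, e) \<in> F \<Longrightarrow> e = z [^]\<^bsub>E\<^esub> n"
  shows "partial_hom G E {(a \<otimes>\<^bsub>G\<^esub> x [^]\<^bsub>G\<^esub> n, e \<otimes>\<^bsub>E\<^esub> z [^]\<^bsub>E\<^esub> n) | a e (n::int). (a, e) \<in> F}"
    (is "partial_hom G E ?F'")
proof -
  note FD = partial_homD[OF F]
  have "subgroup ?F' (G \<times>\<times> E)"
  proof (rule GE.subgroupI)
    show "?F' \<subseteq> carrier (G \<times>\<times> E)"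
      using FD x z by auto
    show "?F' \<noteq> {}"
      using FD(3) by blast
  next
    fix p assume "p \<in> ?F'"
    then obtain a e and n :: int where p: "(a, e) \<in> F" "p = (a \<otimes>\<^bsub>G\<^esub> x [^]\<^bsub>G\<^esub> n, e \<otimes>\<^bsub>E\<^esub> z [^]\<^bsub>E\<^esub> n)"
      by blast
    note ae = FD(1,2)[OF p(1)]
    have "inv\<^bsub>G \<times>\<times> E\<^esub> p = (inv\<^bsub>G\<^esub> a \<otimes>\<^bsub>G\<^esub> x [^]\<^bsub>G\<^esub> (- n), inv\<^bsub>E\<^esub> e \<otimes>\<^bsub>E\<^esub> z [^]\<^bsub>E\<^esub> (- n))"
      using p ae x z by (simp add: G.inv_mult E.inv_mult G.int_pow_neg E.int_pow_neg)
    then show "inv\<^bsub>G \<times>\<times> E\<^esub> p \<in> ?F'"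
      using FD(5)[OF p(1)] by blast
    fix q assume "q \<in> ?F'"
    then obtain b d and m :: int where q: "(b, d) \<in> F" "q = (b \<otimes>\<^bsub>G\<^esub> x [^]\<^bsub>G\<^esub> m, d \<otimes>\<^bsub>E\<^esub> z [^]\<^bsub>E\<^esub> m)"
      by blast
    note bd = FD(1,2)[OF q(1)]
    have "p \<otimes>\<^bsub>G \<times>\<times> E\<^esub> q
        = ((a \<otimes>\<^bsub>G\<^esub> b) \<otimes>\<^bsub>G\<^esub> x [^]\<^bsub>G\<^esub> (n + m), (e \<otimes>\<^bsub>E\<^esub> d) \<otimes>\<^bsub>E\<^esub> z [^]\<^bsub>E\<^esub> (n + m))"
      using p q ae bd x z
      by (simp add: G.int_pow_mult E.int_pow_mult G.m_ac E.m_ac)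
    then show "p \<otimes>\<^bsub>G \<times>\<times> E\<^esub> q \<in> ?F'"
      using FD(4)[OF p(1) q(1)] by blast
  qed
  moreover have "e \<otimes>\<^bsub>E\<^esub> z [^]\<^bsub>E\<^esub> n = \<one>\<^bsub>E\<^esub>" if ae: "(a, e) \<in> F" and a: "a \<otimes>\<^bsub>G\<^esub> x [^]\<^bsub>G\<^esub> n = \<one>\<^bsub>G\<^esub>" for a e and n :: int
  proof -
    have "x [^]\<^bsub>G\<^esub> n = inv\<^bsub>G\<^esub> a"
      using G.inv_equality[OF _ FD(1)[OF ae], of "x [^]\<^bsub>G\<^esub> n"] a x FD(1)[OF ae] by (simp add: G.m_comm)
    then have "inv\<^bsub>E\<^esub> e = z [^]\<^bsub>E\<^esub> n"
      using FD(5)[OF ae] compat[of n "inv\<^bsub>E\<^esub> e"] by simp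
    then show ?thesis
      using FD(2)[OF ae] E.r_inv[of e] by simp
  qed
  ultimately show ?thesis
    unfolding partial_hom_def by (auto dest: sym)
qed

text \<open>Zorn's lemma yields a maximal graph above that of \<open>f\<close>. Its domain is the
  whole group, since any missing \<open>x\<close> could be adjoined once a compatible value for it
  is found; divisibility provides that value.\<close>

theorem hom_extends_to_divisible_group:
  assumes div: "\<And>c n. c \<in> carrier E \<Longrightarrow> n > 0 \<Longrightarrow> \<exists>z\<in>carrier E. z [^]\<^bsub>E\<^esub> (n::nat) = c"
    and A: "subgroup A G" and f: "f \<in> hom (G\<lparr>carrier := A\<rparr>) E"
  obtains g where "g \<in> hom G E" "\<And>a. a \<in> A \<Longrightarrow> g a = f a"
proof -
  define P where "P = {F. partial_hom G E F \<and> (\<lambda>a. (a, f a)) ` A \<subseteq> F}"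
  have "\<exists>M\<in>P. \<forall>Y\<in>P. M \<subseteq> Y \<longrightarrow> Y = M"
  proof (rule subset_Zorn_nonempty)
    show "P \<noteq> {}"
      using partial_hom_graph[OF A f] by (auto simp: P_def)
    fix C assume ne: "C \<noteq> {}" and "subset.chain P C"
    then have "C \<subseteq> P" and chain: "\<And>F F'. F \<in> C \<Longrightarrow> F' \<in> C \<Longrightarrow> F \<subseteq> F' \<or> F' \<subseteq> F"
      unfolding subset.chain_def by blast+
    then have C: "\<And>F. F \<in> C \<Longrightarrow> partial_hom G E F" "\<And>F. F \<in> C \<Longrightarrow> (\<lambda>a. (a, f a)) ` A \<subseteq> F"
      by (auto simp: P_def)
    have sub: "\<And>F. F \<in> C \<Longrightarrow> subgroup F (G \<times>\<times> E)"
      using C by (simp add: partial_hom_def)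
    have "subgroup (\<Union>C) (G \<times>\<times> E)"
    proof (rule GE.subgroupI)
      show "\<Union>C \<subseteq> carrier (G \<times>\<times> E)"
        using subgroup.subset[OF sub] by blast
      show "\<Union>C \<noteq> {}"
        using ne subgroup.one_closed[OF sub] by blast
      show "inv\<^bsub>G \<times>\<times> E\<^esub> p \<in> \<Union>C" if "p \<in> \<Union>C" for p
        using that subgroup.m_inv_closed[OF sub] by (meson UnionE UnionI)
      fix p q assume "p \<in> \<Union>C" "q \<in> \<Union>C"
      then obtain F where "F \<in> C" "p \<in> F" "q \<in> F"
        using chain by blast
      then show "p \<otimes>\<^bsub>G \<times>\<times> E\<^esub> q \<in> \<Union>C"
        using subgroup.m_closed[OF sub] by (meson UnionI)
    qed
    moreover have "(\<lambda>a. (a, f a)) ` A \<subseteq> \<Union>C"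
      using ne C(2) by blast
    ultimately show "\<Union>C \<in> P"
      using C(1) by (auto simp: partial_hom_def P_def)
  qed
  then obtain F where F: "partial_hom G E F" "(\<lambda>a. (a, f a)) ` A \<subseteq> F"
    and max: "\<And>Y. partial_hom G E Y \<Longrightarrow> F \<subseteq> Y \<Longrightarrow> Y = F"
    by (auto simp: P_def)
  note FD = partial_homD[OF F(1)]
  obtain g where g: "subgroup (Domain F) G" "g \<in> hom (G\<lparr>carrier := Domain F\<rparr>) E"
    "\<And>a e. (a, e) \<in> F \<Longrightarrow> g a = e"
    by (rule partial_hom_function[OF F(1)]) blast
  have "x \<in> Domain F" if x: "x \<in> carrier G" for x
  proof -
    have "\<exists>z\<in>carrier E. \<forall>(n::int) e. (x [^]\<^bsub>G\<^esub> n, e) \<in> F \<longrightarrow> e = z [^]\<^bsub>E\<^esub> n"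
    proof (cases "\<exists>k::nat. k > 0 \<and> x [^]\<^bsub>G\<^esub> k \<in> Domain F")
      case True
      \<comment> \<open>The exponents that send \<open>x\<close> into the domain are the multiples
        of the least positive one. Compatibility therefore has to be arranged at \<open>k\<close>
        only, by taking for \<open>z\<close> a \<open>k\<close>-th root of the value at that
        power.\<close>
      define k where "k = (LEAST k::nat. k > 0 \<and> x [^]\<^bsub>G\<^esub> k \<in> Domain F)"
      have k: "k > 0" "x [^]\<^bsub>G\<^esub> k \<in> Domain F"
        using LeastI_ex[OF True] by (auto simp: k_def)
      have least: "\<And>j. j < k \<Longrightarrow> j > 0 \<Longrightarrow> x [^]\<^bsub>G\<^esub> j \<notin> Domain F"
        using not_less_Least unfolding k_def by blast
      obtain c where c: "(x [^]\<^bsub>G\<^esub> k, c) \<in> F"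
        using k by blast
      obtain z where z: "z \<in> carrier E" "z [^]\<^bsub>E\<^esub> k = c"
        using div[OF FD(2)[OF c] k(1)] by blast
      interpret D: subgroup "Domain F" G by fact
      have "e = z [^]\<^bsub>E\<^esub> n" if e: "(x [^]\<^bsub>G\<^esub> n, e) \<in> F" for n :: int and e
      proof -
        have powF: "(x [^]\<^bsub>G\<^esub> (int k * q), z [^]\<^bsub>E\<^esub> (int k * q)) \<in> F" for q :: int
        proof -
          have sub: "subgroup F (G \<times>\<times> E)"
            using F(1) by (simp add: partial_hom_def)
          have pw: "(x [^]\<^bsub>G\<^esub> (int k * int i), z [^]\<^bsub>E\<^esub> (int k * int i)) \<in> F" for i :: nat
          proof (induction i)
            case (Suc i)
            have Suc_i: "int k * int (Suc i) = int k * int i + int k"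
              by (simp add: algebra_simps)
            have "x [^]\<^bsub>G\<^esub> (int k * int (Suc i)) = x [^]\<^bsub>G\<^esub> (int k * int i) \<otimes>\<^bsub>G\<^esub> x [^]\<^bsub>G\<^esub> k"
              unfolding Suc_i using x by (simp add: G.int_pow_mult int_pow_int)
            moreover have "z [^]\<^bsub>E\<^esub> (int k * int (Suc i)) = z [^]\<^bsub>E\<^esub> (int k * int i) \<otimes>\<^bsub>E\<^esub> c"
              unfolding Suc_i z(2)[symmetric] using z(1) by (simp add: E.int_pow_mult int_pow_int)
            ultimately show ?case
              using FD(4)[OF Suc c] by simp
          qed (use FD(3) in simp)
          show ?thesis
          proof (cases "q \<ge> 0")
            case True
            then show ?thesis
              using pw[of "nat q"] by simp
          next
            case False
            then show ?thesis
              using FD(5)[OF pw[of "nat (- q)"]] x z by (simp flip: G.int_pow_neg E.int_pow_neg)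
          qed
        qed
        \<comment> \<open>Division with remainder: the remainder is an exponent below
          \<open>k\<close> that still leads into the domain, hence it is zero.\<close>
        have "x [^]\<^bsub>G\<^esub> (n mod int k) \<in> Domain F"
        proof -
          have "n mod int k = n + (- (int k * (n div int k)))"
            by (simp add: minus_mult_div_eq_mod)
          then have "x [^]\<^bsub>G\<^esub> (n mod int k) = x [^]\<^bsub>G\<^esub> n \<otimes>\<^bsub>G\<^esub> inv\<^bsub>G\<^esub> (x [^]\<^bsub>G\<^esub> (int k * (n div int k)))"
            using x by (simp only: G.int_pow_mult G.int_pow_neg)
          then show ?thesis
            using e powF by (metis D.m_closed D.m_inv_closed DomainI)
        qed
        moreover have mod: "n mod int k \<ge> 0" "n mod int k < int k"
          using k by auto
        ultimately have "x [^]\<^bsub>G\<^esub> nat (n mod int k) \<in> Domain F"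
          using int_pow_int[of G x "nat (n mod int k)"] by (simp only: int_nat_eq if_True)
        then have "\<not> nat (n mod int k) > 0"
          using least[of "nat (n mod int k)"] mod nat_less_iff[of "n mod int k" k] by blast
        then have "int k * (n div int k) = n"
          using mod mult_div_mod_eq[of "int k" n] by linarith
        then show ?thesis
          using FD(6)[OF e] powF[of "n div int k"] by simp
      qed
      then show ?thesis
        using z by blast
    next
      case False
      \<comment> \<open>No power of \<open>x\<close> with nonzero exponent lies in the domain, so
        every value is compatible; the unit is taken.\<close>
      have "e = \<one>\<^bsub>E\<^esub> [^]\<^bsub>E\<^esub> n" if e: "(x [^]\<^bsub>G\<^esub> n, e) \<in> F" for n :: int and e
      proof -
        have "x [^]\<^bsub>G\<^esub> (- n) \<in> Domain F"
          using FD(5)[OF e] x by (auto simp: G.int_pow_neg)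
        moreover obtain m where m: "n = int m \<or> n = - int m"
          by (cases n rule: int_cases2) auto
        ultimately have "x [^]\<^bsub>G\<^esub> m \<in> Domain F"
          using e by (auto simp: int_pow_int)
        then have "m = 0"
          using False by (metis gr0I)
        then have "n = 0"
          using m by simp
        then show ?thesis
          using e FD(6)[OF e] FD(3) x by simp
      qed
      then show ?thesis
        using E.one_closed by meson
    qed
    then obtain z where z: "z \<in> carrier E" "\<And>(n::int) e. (x [^]\<^bsub>G\<^esub> n, e) \<in> F \<Longrightarrow> e = z [^]\<^bsub>E\<^esub> n"
      by blast
    let ?F' = "{(a \<otimes>\<^bsub>G\<^esub> x [^]\<^bsub>G\<^esub> n, e \<otimes>\<^bsub>E\<^esub> z [^]\<^bsub>E\<^esub> n) | a e (n::int). (a, e) \<in> F}"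
    have "F \<subseteq> ?F'"
    proof clarify
      fix a e assume ae: "(a, e) \<in> F"
      then have "(a, e) = (a \<otimes>\<^bsub>G\<^esub> x [^]\<^bsub>G\<^esub> (0::int), e \<otimes>\<^bsub>E\<^esub> z [^]\<^bsub>E\<^esub> (0::int))"
        using FD(1,2)[OF ae] by simp
      then show "\<exists>a' e' (n::int). (a, e) = (a' \<otimes>\<^bsub>G\<^esub> x [^]\<^bsub>G\<^esub> n, e' \<otimes>\<^bsub>E\<^esub> z [^]\<^bsub>E\<^esub> n) \<and> (a', e') \<in> F"
        using ae by blast
    qed
    then have "?F' = F"
      using max partial_hom_adjoin[OF F(1) x z] by blast
    moreover have "(x, z) \<in> ?F'"
    proof -
      have "(x, z) = (\<one>\<^bsub>G\<^esub> \<otimes>\<^bsub>G\<^esub> x [^]\<^bsub>G\<^esub> (1::int), \<one>\<^bsub>E\<^esub> \<otimes>\<^bsub>E\<^esub> z [^]\<^bsub>E\<^esub> (1::int))"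
        using x z by simp
      then show ?thesis
        using FD(3) by blast
    qed
    ultimately show ?thesis
      by blast
  qed
  then have "Domain F = carrier G"
    using subgroup.subset[OF g(1)] by blast
  then have "g \<in> hom G E"
    using g(2) by (simp add: hom_def)
  moreover have "g a = f a" if "a \<in> A" for a
    using that F(2) g(3) by blast
  ultimately show ?thesis
    using that by blast
qed

end

section \<open>Counting the characters of a finite abelian group\<close>

text \<open>\<open>extensional\<close> gives each character of \<open>A\<close> a single
  representative, so that cardinalities count characters and not arbitrary values outside
  \<open>A\<close>.\<close>

definition subgroup_characters :: "('a, 'c) monoid_scheme \<Rightarrow> 'a set \<Rightarrow> ('a \<Rightarrow> complex) set"
  where "subgroup_characters G A = hom (G\<lparr>carrier := A\<rparr>) circle_group \<inter> extensional A"

lemma subgroup_characters_iff: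
  "\<chi> \<in> subgroup_characters G A \<longleftrightarrow> \<chi> \<in> extensional A \<and> (\<forall>a\<in>A. cmod (\<chi> a) = 1) \<and>
    (\<forall>a\<in>A. \<forall>b\<in>A. \<chi> (a \<otimes>\<^bsub>G\<^esub> b) = \<chi> a * \<chi> b)"
  by (auto simp: subgroup_characters_def hom_def circle_group_def)

lemma circle_group_nat_pow: "z [^]\<^bsub>circle_group\<^esub> (n::nat) = z ^ n"
  by (induction n) (simp_all add: nat_pow_def circle_group_def)

context comm_group
begin

section \<open>Adjoining one element to a subgroup of an abelian group\<close>

context
  fixes A x k B
  assumes A: "subgroup A G" and x: "x \<in> carrier G" and k: "(k::nat) > 0" "x [^] k \<in> A"
    and least: "\<And>j. 0 < j \<Longrightarrow> j < k \<Longrightarrow> x [^] j \<notin> A"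
  defines "B \<equiv> (\<lambda>(a, i). a \<otimes> x [^] i) ` (A \<times> {..<k})"
begin

interpretation A: subgroup A G by (rule A)

text \<open>\<open>k\<close> is the order of \<open>x\<close> modulo \<open>A\<close>. Two equal
  products with exponents \<open>i \<le> j\<close> put \<open>x [^] (j - i)\<close> into
  \<open>A\<close>, which for an exponent below \<open>k\<close> is possible only if it is
  zero.\<close>

lemma inj_on_adjoin: "inj_on (\<lambda>(a, i). a \<otimes> x [^] i) (A \<times> {..<k})"
proof -
  have *: "a = b \<and> i = j" if ab: "a \<in> A" "b \<in> A" and "j < k" "i \<le> j" and eq: "a \<otimes> x [^] i = b \<otimes> x [^] j"
    for a b and i j :: nat
  proof -
    have "x [^] j = x [^] (j - i) \<otimes> x [^] i"
      using x \<open>i \<le> j\<close> by (simp add: nat_pow_mult)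
    then have "a = b \<otimes> x [^] (j - i)"
      using eq ab x A.mem_carrier by (simp flip: m_assoc)
    then have "x [^] (j - i) = inv b \<otimes> a"
      using ab x A.mem_carrier by (simp add: inv_solve_left)
    then have "x [^] (j - i) \<in> A"
      using ab by simp
    then have "i = j"
      using least[of "j - i"] \<open>j < k\<close> \<open>i \<le> j\<close> by force
    then show ?thesis
      using eq ab x A.mem_carrier by simp
  qed
  show ?thesis
  proof (rule inj_onI, clarsimp)
    fix a i b j assume "a \<in> A" "i < k" "b \<in> A" "j < k" "a \<otimes> x [^] i = b \<otimes> x [^] j"
    then show "a = b \<and> i = j"
      using *[of a b j i] *[of b a i j] by (cases "i \<le> j") auto
  qed
qed

lemma card_adjoin: "card B = card A * k"
  using card_image[OF inj_on_adjoin] by (simp add: B_def card_cartesian_product)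

lemma pow_mod_in: "\<exists>a\<in>A. x [^] (n::int) = a \<otimes> x [^] nat (n mod int k)"
proof -
  have "x [^] n = x [^] (int k * (n div int k)) \<otimes> x [^] (n mod int k)"
    by (simp only: mult_div_mod_eq int_pow_mult[OF x, symmetric])
  also have "x [^] (int k * (n div int k)) = (x [^] k) [^] (n div int k)"
    using int_pow_pow[OF x, of "int k" "n div int k"] by (simp add: int_pow_int)
  also have "x [^] (n mod int k) = x [^] nat (n mod int k)"
    using k(1) int_pow_int[of G x "nat (n mod int k)"] by simp
  finally show ?thesis
    using subgroup_int_pow_closed[OF A k(2)] by blast
qed

text \<open>Exponents below \<open>k\<close> describe each element of \<open>B\<close> once, which
  suits counting. With integer exponents \<open>B\<close> is visibly closed under the group
  operations, and it matches the domain built in \<open>partial_hom_adjoin\<close>.\<close>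

lemma adjoin_iff: "b \<in> B \<longleftrightarrow> (\<exists>a\<in>A. \<exists>n::int. b = a \<otimes> x [^] n)"
proof
  assume "b \<in> B"
  then show "\<exists>a\<in>A. \<exists>n::int. b = a \<otimes> x [^] n"
    unfolding B_def by (auto simp flip: int_pow_int)
next
  assume "\<exists>a\<in>A. \<exists>n::int. b = a \<otimes> x [^] n"
  then obtain a and n :: int where b: "a \<in> A" "b = a \<otimes> x [^] n"
    by blast
  obtain c where c: "c \<in> A" "x [^] n = c \<otimes> x [^] nat (n mod int k)"
    using pow_mod_in by blast
  have "b = (a \<otimes> c) \<otimes> x [^] nat (n mod int k)"
    using b c x A.mem_carrier by (simp add: m_assoc)
  moreover have "nat (n mod int k) < k"
    using k(1) by (simp add: nat_less_iff)
  ultimately show "b \<in> B"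
    unfolding B_def using b c by (intro image_eqI[of _ _ "(a \<otimes> c, nat (n mod int k))"]) auto
qed

lemma subgroup_adjoin: "subgroup B G"
proof (rule subgroupI)
  show "B \<subseteq> carrier G"
    using x A.mem_carrier by (auto simp: B_def)
  show "B \<noteq> {}"
    unfolding B_def using k(1) A.one_closed by blast
  fix b assume "b \<in> B"
  then obtain a and n :: int where b: "a \<in> A" "b = a \<otimes> x [^] n"
    unfolding adjoin_iff by blast
  then have "inv b = inv a \<otimes> x [^] (- n)"
    using x A.mem_carrier by (simp add: inv_mult int_pow_neg)
  then show "inv b \<in> B"
    unfolding adjoin_iff using b by blast
  fix d assume "d \<in> B"
  then obtain c and m :: int where d: "c \<in> A" "d = c \<otimes> x [^] m"
    unfolding adjoin_iff by blast
  then have "b \<otimes> d = (a \<otimes> c) \<otimes> x [^] (n + m)"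
    using b x A.mem_carrier by (simp add: int_pow_mult m_ac)
  then show "b \<otimes> d \<in> B"
    unfolding adjoin_iff using b d by blast
qed

lemma subset_adjoin: "A \<subseteq> B" "x \<in> B"
proof -
  show "A \<subseteq> B"
  proof
    fix a assume "a \<in> A"
    then have "a = a \<otimes> x [^] (0::int)"
      using A.mem_carrier by simp
    then show "a \<in> B"
      unfolding adjoin_iff using \<open>a \<in> A\<close> by blast
  qed
  have "x = \<one> \<otimes> x [^] (1::int)"
    using x by simp
  then show "x \<in> B"
    unfolding adjoin_iff using A.one_closed by blast
qed

text \<open>A character of \<open>B\<close> amounts to its restriction to \<open>A\<close> together
  with its value at \<open>x\<close>, which may be any \<open>k\<close>-th root of the value at
  \<open>x [^] k\<close>. A nonzero complex number has exactly \<open>k\<close> such roots, whence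
  the factor.\<close>

lemma card_subgroup_characters_adjoin:
  assumes fin: "finite (subgroup_characters G A)"
  shows "finite (subgroup_characters G B)"
    and "card (subgroup_characters G B) = card (subgroup_characters G A) * k"
proof -
  interpret B: subgroup B G by (rule subgroup_adjoin)
  interpret comm_group_pair G circle_group
    using comm_group_circle_group by (intro comm_group_pair.intro comm_group_axioms)
  let ?P = "SIGMA \<chi>:subgroup_characters G A. {z. z ^ k = \<chi> (x [^] k)}"
  let ?h = "\<lambda>\<psi>. (restrict \<psi> A, \<psi> x)"
  have pow: "\<psi> (x [^] n) = \<psi> x ^ n" if "\<psi> \<in> subgroup_characters G B" for \<psi> and n :: nat
  proof (induction n)
    case 0
    have "\<psi> \<one> * \<psi> \<one> = \<psi> \<one>" "cmod (\<psi> \<one>) = 1"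
      using that B.one_closed unfolding subgroup_characters_iff by (metis l_one one_closed, blast)
    then show ?case by auto
  next
    case (Suc n)
    have "x [^] n \<in> B"
      using subset_adjoin(2) by (induction n) auto
    then show ?case
      using that Suc subset_adjoin(2) by (auto simp: subgroup_characters_iff)
  qed
  have "bij_betw ?h (subgroup_characters G B) ?P"
  proof (rule bij_betwI')
    fix \<psi> \<phi> assume psi: "\<psi> \<in> subgroup_characters G B" and phi: "\<phi> \<in> subgroup_characters G B"
    show "?h \<psi> = ?h \<phi> \<longleftrightarrow> \<psi> = \<phi>"
    proof
      assume eq: "?h \<psi> = ?h \<phi>"
      have "\<psi> b = \<phi> b" if bB: "b \<in> B" for b
      proof -
        obtain a i where b: "a \<in> A" "b = a \<otimes> x [^] (i::nat)"
          using bB by (auto simp: B_def)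
        have "x [^] i \<in> B"
          using subset_adjoin(2) by (induction i) auto
        then have "\<psi> b = \<psi> a * \<psi> x ^ i" "\<phi> b = \<phi> a * \<phi> x ^ i"
          using psi phi b subset_adjoin(1) pow by (auto simp: subgroup_characters_iff)
        moreover have "\<psi> a = \<phi> a" "\<psi> x = \<phi> x"
          using eq b(1) by (metis Pair_inject restrict_apply')+
        ultimately show ?thesis by simp
      qed
      then show "\<psi> = \<phi>"
        using psi phi by (auto simp: subgroup_characters_def intro: extensionalityI)
    qed simp
  next
    fix \<psi> assume psi: "\<psi> \<in> subgroup_characters G B"
    then show "?h \<psi> \<in> ?P"
      using subset_adjoin(1) pow[OF psi, of k] k(2) by (auto simp: subgroup_characters_iff)
  next
    fix p assume "p \<in> ?P"
    then obtain \<chi> z where p: "p = (\<chi>, z)" and chi: "\<chi> \<in> subgroup_characters G A" and z: "z ^ k = \<chi> (x [^] k)"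
      by blast
    \<comment> \<open>A root of a number of modulus 1 has modulus 1, so all complex roots that are
      counted lie on the circle.\<close>
    have "cmod z ^ k = 1"
      using z chi k(2) by (auto simp: subgroup_characters_iff simp flip: norm_power)
    then have z1: "z \<in> carrier circle_group"
      using k(1) using power_eq_imp_eq_base[of "cmod z" k 1] by (simp add: circle_group_def)
    let ?F = "(\<lambda>a. (a, \<chi> a)) ` A"
    have F: "partial_hom G circle_group ?F"
      using partial_hom_graph[OF A] chi by (simp add: subgroup_characters_def)
    note FD = partial_homD[OF F]
    \<comment> \<open>Minimality of \<open>k\<close> makes \<open>n\<close> a multiple of
      \<open>k\<close>. The value at \<open>x [^] n\<close> is thus determined by the one at
      \<open>x [^] k\<close>, where \<open>z\<close> is right by its choice.\<close>
    have compat: "e = z [^]\<^bsub>circle_group\<^esub> n" if "(x [^] n, e) \<in> ?F" for n :: int and e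
    proof -
      have xn: "x [^] n \<in> A" "e = \<chi> (x [^] n)"
        using that by auto
      define q where "q = n div int k"
      obtain c where c: "c \<in> A" "x [^] n = c \<otimes> x [^] nat (n mod int k)"
        using pow_mod_in by blast
      have "x [^] nat (n mod int k) = inv c \<otimes> x [^] n"
        using c x A.mem_carrier by (simp add: inv_solve_left)
      then have "x [^] nat (n mod int k) \<in> A"
        using A.m_closed[OF A.m_inv_closed[OF c(1)] xn(1)] by simp
      then have "n mod int k = 0"
        using least[of "nat (n mod int k)"] k(1) by (force simp: nat_less_iff)
      then have n: "n = int k * q"
        by (auto simp: q_def)
      have "\<chi> \<in> hom (G\<lparr>carrier := A\<rparr>) circle_group"
        using chi by (simp add: subgroup_characters_def)
      then interpret chi: group_hom "G\<lparr>carrier := A\<rparr>" circle_group \<chi>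
        using A.subgroup_is_group[OF is_group] by (intro group_hom.intro group_hom_axioms.intro) (auto intro: E.is_group)
      have "x [^] n = (x [^] k) [^]\<^bsub>G\<lparr>carrier := A\<rparr>\<^esub> q"
        using x k(2) by (simp add: n int_pow_consistent[OF A] flip: int_pow_pow int_pow_int)
      then have "e = \<chi> (x [^] k) [^]\<^bsub>circle_group\<^esub> q"
        using xn chi.hom_int_pow[of "x [^] k" q] k(2) by simp
      also have "\<dots> = (z [^]\<^bsub>circle_group\<^esub> k) [^]\<^bsub>circle_group\<^esub> q"
        using z by (simp add: circle_group_nat_pow)
      also have "\<dots> = z [^]\<^bsub>circle_group\<^esub> n"
        using z1 by (simp add: n E.int_pow_pow flip: int_pow_int)
      finally show ?thesis .
    qed
    let ?F' = "{(a \<otimes> x [^] n, e \<otimes>\<^bsub>circle_group\<^esub> z [^]\<^bsub>circle_group\<^esub> n) | a e (n::int). (a, e) \<in> ?F}"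
    have "partial_hom G circle_group ?F'"
      by (rule partial_hom_adjoin[OF F x z1 compat])
    then obtain f where f: "f \<in> hom (G\<lparr>carrier := Domain ?F'\<rparr>) circle_group"
      "\<And>a e. (a, e) \<in> ?F' \<Longrightarrow> f a = e"
      by (rule partial_hom_function) blast
    have "b \<in> Domain ?F' \<longleftrightarrow> b \<in> B" for b
      unfolding adjoin_iff by blast
    then have "Domain ?F' = B"
      by blast
    with f(1) have "f \<in> hom (G\<lparr>carrier := B\<rparr>) circle_group"
      by metis
    then have "restrict f B \<in> subgroup_characters G B"
      using B.m_closed by (auto simp: subgroup_characters_def hom_def)
    moreover have "?h (restrict f B) = p"
    proof -
      have fa: "f a = \<chi> a" if "a \<in> A" for a
      proof (rule f(2))
        have "(a, \<chi> a) = (a \<otimes> x [^] (0::int), \<chi> a \<otimes>\<^bsub>circle_group\<^esub> z [^]\<^bsub>circle_group\<^esub> (0::int))"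
          using that FD(1,2) A.mem_carrier by (simp add: circle_group_def)
        then show "(a, \<chi> a) \<in> ?F'"
          using that by blast
      qed
      have fx: "f x = z"
      proof (rule f(2))
        have "(x, z) = (\<one> \<otimes> x [^] (1::int), \<one>\<^bsub>circle_group\<^esub> \<otimes>\<^bsub>circle_group\<^esub> z [^]\<^bsub>circle_group\<^esub> (1::int))"
          using x z1 by simp
        then show "(x, z) \<in> ?F'"
          using FD(3) by blast
      qed
      have "restrict (restrict f B) A = \<chi>"
        using fa subset_adjoin chi
        by (auto simp: subgroup_characters_def restrict_def extensional_def fun_eq_iff)
      then show ?thesis
        using fx p subset_adjoin by simp
    qed
    ultimately show "\<exists>\<psi>\<in>subgroup_characters G B. p = ?h \<psi>"
      by blast
  qed
  moreover have "finite ?P \<and> card ?P = card (subgroup_characters G A) * k"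
  proof -
    have ne: "\<chi> (x [^] k) \<noteq> 0" if "\<chi> \<in> subgroup_characters G A" for \<chi>
      using that k(2) by (force simp: subgroup_characters_iff)
    then show ?thesis
      using fin finite_nth_roots[OF k(1)] card_nth_roots[OF _ k(1)] by (simp add: card_SigmaI)
  qed
  ultimately show "finite (subgroup_characters G B)"
    and "card (subgroup_characters G B) = card (subgroup_characters G A) * k"
    using bij_betw_finite bij_betw_same_card by fastforce+
qed

end

text \<open>Among the subgroups for which the count is right, one of largest order is taken.
  Adjoining an element \<open>x\<close> multiplies the order and the number of characters by the
  same \<open>k\<close>, so maximality gives \<open>k = 1\<close>, and \<open>x\<close> is in the
  subgroup already.\<close>

theorem card_subgroup_characters:
  assumes fin: "finite (carrier G)"
  shows "finite (subgroup_characters G (carrier G))" (is ?fin)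
    and "card (subgroup_characters G (carrier G)) = card (carrier G)" (is ?card)
proof -
  define P where "P A \<longleftrightarrow> subgroup A G \<and> finite (subgroup_characters G A)
    \<and> card (subgroup_characters G A) = card A" for A
  have "subgroup_characters G {\<one>} = {restrict (\<lambda>_. 1) {\<one>}}"
  proof (intro equalityI subsetI)
    fix \<chi> assume chi: "\<chi> \<in> subgroup_characters G {\<one>}"
    then have "\<chi> \<one> * \<chi> \<one> = \<chi> \<one>" "cmod (\<chi> \<one>) = 1"
      unfolding subgroup_characters_iff by (metis insertI1 l_one one_closed, blast)
    then have "\<chi> \<one> = 1" by auto
    then have "\<chi> = restrict (\<lambda>_. 1) {\<one>}"
      using chi by (auto simp: subgroup_characters_iff extensional_def)
    then show "\<chi> \<in> {restrict (\<lambda>_. 1) {\<one>}}" by simp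
  qed (auto simp: subgroup_characters_iff)
  then have "P {\<one>}"
    by (simp add: P_def triv_subgroup)
  moreover have "\<forall>A. P A \<longrightarrow> card A < Suc (card (carrier G))"
    using fin by (auto simp: P_def less_Suc_eq_le intro: card_mono dest: subgroup.subset)
  ultimately obtain A where PA: "P A" and max: "\<And>B. P B \<Longrightarrow> card B \<le> card A"
    using ex_has_greatest_nat[of P "{\<one>}" card "Suc (card (carrier G))"] by metis
  then have A: "subgroup A G" and finA: "finite A"
    using fin by (auto simp: P_def intro: finite_subset dest: subgroup.subset)
  have "carrier G \<subseteq> A"
  proof
    fix x assume x: "x \<in> carrier G"
    have "x [^] order G \<in> A" "order G > 0"
      using x fin A subgroup.one_closed order_gt_0_iff_finite by (auto simp: pow_order_eq_1)
    then have ex: "\<exists>k::nat. k > 0 \<and> x [^] k \<in> A" by blast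
    define k where "k = (LEAST k::nat. k > 0 \<and> x [^] k \<in> A)"
    have k: "k > 0" "x [^] k \<in> A"
      using LeastI_ex[OF ex] by (auto simp: k_def)
    have least: "\<And>j. 0 < j \<Longrightarrow> j < k \<Longrightarrow> x [^] j \<notin> A"
      using not_less_Least unfolding k_def by blast
    let ?B = "(\<lambda>(a, i). a \<otimes> x [^] i) ` (A \<times> {..<k})"
    have "P ?B"
      using subgroup_adjoin[OF A x k least] card_subgroup_characters_adjoin[OF A x k least]
        card_adjoin[OF A x k least] PA by (simp add: P_def)
    then have "card A * k \<le> card A"
      using max card_adjoin[OF A x k least] by metis
    moreover have "card A > 0"
      using finA subgroup.one_closed[OF A] card_gt_0_iff by blast
    ultimately have "k = 1"
      using k by auto
    then show "x \<in> A"
      using k x by simp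
  qed
  then have "A = carrier G"
    using subgroup.subset[OF A] by blast
  then show ?fin ?card
    using PA by (simp_all add: P_def)
qed

end

section \<open>Left ideals and their homomorphisms\<close>

context ring
begin

lemma left_idealI:
  assumes "I \<subseteq> carrier R" "\<zero> \<in> I" "\<And>a b. a \<in> I \<Longrightarrow> b \<in> I \<Longrightarrow> a \<oplus> b \<in> I"
    and smult: "\<And>r a. r \<in> carrier R \<Longrightarrow> a \<in> I \<Longrightarrow> r \<otimes> a \<in> I"
  shows "left_ideal I R"
proof (intro left_ideal.intro additive_subgroup.intro left_ideal_axioms.intro ring_axioms)
  have "\<ominus> a \<in> I" if "a \<in> I" for a
    using smult[of "\<ominus> \<one>" a] that assms(1) by (auto simp: l_minus)
  then show "subgroup I (add_monoid R)"
    using assms by (intro add.subgroupI) auto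
qed (use smult in auto)

lemma left_idealD:
  assumes "left_ideal I R"
  shows "a \<in> I \<Longrightarrow> a \<in> carrier R" "\<zero> \<in> I" "a \<in> I \<Longrightarrow> b \<in> I \<Longrightarrow> a \<oplus> b \<in> I"
    "r \<in> carrier R \<Longrightarrow> a \<in> I \<Longrightarrow> r \<otimes> a \<in> I" "a \<in> I \<Longrightarrow> \<ominus> a \<in> I" "a \<in> I \<Longrightarrow> b \<in> I \<Longrightarrow> a \<ominus> b \<in> I"
proof -
  interpret left_ideal I R by fact
  show "a \<in> I \<Longrightarrow> a \<in> carrier R" "\<zero> \<in> I" "a \<in> I \<Longrightarrow> b \<in> I \<Longrightarrow> a \<oplus> b \<in> I"
    "r \<in> carrier R \<Longrightarrow> a \<in> I \<Longrightarrow> r \<otimes> a \<in> I" "a \<in> I \<Longrightarrow> \<ominus> a \<in> I"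
    using a_subset a_closed l_closed zero_closed a_inv_closed by auto
  then show "a \<in> I \<Longrightarrow> b \<in> I \<Longrightarrow> a \<ominus> b \<in> I"
    by (simp add: a_minus_def)
qed

lemma minimal_left_idealD:
  assumes "minimal_left_ideal M R"
  shows "left_ideal M R" "M \<noteq> {\<zero>}"
    "left_ideal I R \<Longrightarrow> I \<subseteq> M \<Longrightarrow> I = {\<zero>} \<or> I = M"
  using assms by (auto simp: minimal_left_ideal_def minimal_left_ideal_axioms_def)

lemma mem_set_add_iff: "x \<in> A <+> B \<longleftrightarrow> (\<exists>a\<in>A. \<exists>b\<in>B. x = a \<oplus> b)"
  by (auto simp: set_add_def')

lemma left_ideal_zero: "left_ideal {\<zero>} R"
  by (rule left_idealI) auto

lemma left_ideal_carrier: "left_ideal (carrier R) R"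
  by (rule left_idealI) auto

lemma left_ideal_Int:
  assumes "left_ideal A R" "left_ideal B R"
  shows "left_ideal (A \<inter> B) R"
  using left_idealD[OF assms(1)] left_idealD[OF assms(2)] by (intro left_idealI) auto

lemma left_ideal_set_add:
  assumes A: "left_ideal A R" and B: "left_ideal B R"
  shows "left_ideal (A <+> B) R"
proof (rule left_idealI)
  note AD = left_idealD[OF A] and BD = left_idealD[OF B]
  show "A <+> B \<subseteq> carrier R"
    using AD(1) BD(1) by (auto simp: mem_set_add_iff)
  show "\<zero> \<in> A <+> B"
    unfolding mem_set_add_iff using AD(2) BD(2) by (intro bexI[of _ \<zero>]) auto
  fix x :: 'a assume "x \<in> A <+> B"
  then obtain a b where x: "a \<in> A" "b \<in> B" "x = a \<oplus> b"
    by (auto simp: mem_set_add_iff)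
  show "r \<otimes> x \<in> A <+> B" if r: "r \<in> carrier R" for r
    unfolding mem_set_add_iff using x r AD(1,4) BD(1,4)
    by (intro bexI[of _ "r \<otimes> a"] bexI[of _ "r \<otimes> b"]) (auto simp: r_distr)
  fix y :: 'a assume "y \<in> A <+> B"
  then obtain c d where y: "c \<in> A" "d \<in> B" "y = c \<oplus> d"
    by (auto simp: mem_set_add_iff)
  have "x \<oplus> y = (a \<oplus> c) \<oplus> (b \<oplus> d)"
    using x y AD(1) BD(1) by (simp add: a_ac)
  then show "x \<oplus> y \<in> A <+> B"
    unfolding mem_set_add_iff using x y AD(3) BD(3) by blast
qed

lemma set_add_upper:
  assumes A: "left_ideal A R" and B: "left_ideal B R"
  shows "A \<subseteq> A <+> B" "B \<subseteq> A <+> B"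
proof -
  have "a = a \<oplus> \<zero>" "b = \<zero> \<oplus> b" if "a \<in> A" "b \<in> B" for a b
    using that left_idealD(1)[OF A] left_idealD(1)[OF B] by auto
  then show "A \<subseteq> A <+> B" "B \<subseteq> A <+> B"
    unfolding subset_iff mem_set_add_iff using left_idealD(2)[OF A] left_idealD(2)[OF B] by blast+
qed

lemma set_add_least:
  fixes A B C :: "'a set"
  assumes "left_ideal C R" "A \<subseteq> C" "B \<subseteq> C"
  shows "A <+> B \<subseteq> C"
  using assms(2,3) left_idealD(3)[OF assms(1)] by (auto simp: mem_set_add_iff subset_iff)

lemma left_ideal_principal:
  assumes a: "a \<in> carrier R"
  shows "left_ideal ((\<lambda>r. r \<otimes> a) ` carrier R) R"
proof (rule left_idealI)
  show "\<zero> \<in> (\<lambda>r. r \<otimes> a) ` carrier R"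
    using a by (intro image_eqI[of _ _ \<zero>]) auto
  fix x assume "x \<in> (\<lambda>r. r \<otimes> a) ` carrier R"
  then obtain r where r: "r \<in> carrier R" "x = r \<otimes> a" by blast
  show "s \<otimes> x \<in> (\<lambda>r. r \<otimes> a) ` carrier R" if "s \<in> carrier R" for s
    using that r a by (intro image_eqI[of _ _ "s \<otimes> r"]) (auto simp: m_assoc)
  fix y assume "y \<in> (\<lambda>r. r \<otimes> a) ` carrier R"
  then obtain s where s: "s \<in> carrier R" "y = s \<otimes> a" by blast
  show "x \<oplus> y \<in> (\<lambda>r. r \<otimes> a) ` carrier R"
    using r s a by (intro image_eqI[of _ _ "r \<oplus> s"]) (auto simp: l_distr)
qed (use a in auto)

lemma generator_in_principal:
  assumes "a \<in> carrier R"
  shows "a \<in> (\<lambda>r. r \<otimes> a) ` carrier R"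
  using assms by (intro image_eqI[of _ _ \<one>]) auto

lemma principal_subset:
  assumes "left_ideal I R" "a \<in> I"
  shows "(\<lambda>r. r \<otimes> a) ` carrier R \<subseteq> I"
  using left_idealD(4)[OF assms(1)] assms(2) by auto

lemma left_ideal_annihilator:
  assumes "a \<in> carrier R"
  shows "left_ideal {r \<in> carrier R. r \<otimes> a = \<zero>} R"
  using assms by (intro left_idealI) (auto simp: l_distr m_assoc)

lemma direct_sum_unique:
  assumes A: "left_ideal A R" and B: "left_ideal B R" and AB: "A \<inter> B = {\<zero>}"
    and ab: "a \<in> A" "a' \<in> A" "b \<in> B" "b' \<in> B" and eq: "a \<oplus> b = a' \<oplus> b'"
  shows "a = a'" "b = b'"
proof -
  have c: "a \<in> carrier R" "a' \<in> carrier R" "b \<in> carrier R" "b' \<in> carrier R"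
    using ab left_idealD(1)[OF A] left_idealD(1)[OF B] by auto
  have "a \<ominus> a' = (a \<oplus> b) \<oplus> (\<ominus> b \<ominus> a')"
    using c by (simp add: a_minus_def a_assoc r_neg2)
  also have "\<dots> = (b' \<ominus> b) \<oplus> (a' \<ominus> a')"
    unfolding eq using c by (simp add: a_minus_def a_ac)
  finally have "a \<ominus> a' = b' \<ominus> b"
    using c by simp
  then have "a \<ominus> a' \<in> A \<inter> B"
    using left_idealD(6)[OF A ab(1,2)] left_idealD(6)[OF B ab(4,3)] by simp
  then show "a = a'"
    using AB c by simp
  then show "b = b'"
    using eq c by simp
qed

section \<open>Homomorphisms between left ideals, as extensional functions that can be
  counted\<close>

definition left_ideal_homs :: "'a set \<Rightarrow> 'a set \<Rightarrow> ('a \<Rightarrow> 'a) set"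
  where "left_ideal_homs A B = {f \<in> A \<rightarrow>\<^sub>E B. (\<forall>x\<in>A. \<forall>y\<in>A. f (x \<oplus> y) = f x \<oplus> f y)
    \<and> (\<forall>r\<in>carrier R. \<forall>x\<in>A. f (r \<otimes> x) = r \<otimes> f x)}"

lemma left_ideal_homsI:
  assumes "\<And>x. x \<in> A \<Longrightarrow> f x \<in> B" "f \<in> extensional A"
    "\<And>x y. x \<in> A \<Longrightarrow> y \<in> A \<Longrightarrow> f (x \<oplus> y) = f x \<oplus> f y"
    "\<And>r x. r \<in> carrier R \<Longrightarrow> x \<in> A \<Longrightarrow> f (r \<otimes> x) = r \<otimes> f x"
  shows "f \<in> left_ideal_homs A B"
  using assms by (auto simp: left_ideal_homs_def PiE_def)

lemma left_ideal_homsD: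
  assumes "f \<in> left_ideal_homs A B"
  shows "x \<in> A \<Longrightarrow> f x \<in> B" "f \<in> extensional A"
    "x \<in> A \<Longrightarrow> y \<in> A \<Longrightarrow> f (x \<oplus> y) = f x \<oplus> f y"
    "r \<in> carrier R \<Longrightarrow> x \<in> A \<Longrightarrow> f (r \<otimes> x) = r \<otimes> f x"
  using assms by (auto simp: left_ideal_homs_def PiE_def)

lemma left_ideal_homs_zero:
  assumes A: "left_ideal A R" and B: "left_ideal B R" and f: "f \<in> left_ideal_homs A B"
  shows "f \<zero> = \<zero>"
  using left_ideal_homsD(4)[OF f zero_closed left_idealD(2)[OF A]]
    left_idealD(1)[OF B left_ideal_homsD(1)[OF f left_idealD(2)[OF A]]] by simp

lemma left_ideal_homs_minus:
  assumes A: "left_ideal A R" and B: "left_ideal B R" and f: "f \<in> left_ideal_homs A B"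
    and x: "x \<in> A" and y: "y \<in> A"
  shows "f (x \<ominus> y) = f x \<ominus> f y"
proof -
  have "\<ominus> y = (\<ominus> \<one>) \<otimes> y" "\<ominus> f y = (\<ominus> \<one>) \<otimes> f y"
    using y left_idealD(1)[OF A] left_idealD(1)[OF B] left_ideal_homsD(1)[OF f] by (auto simp: l_minus)
  then have "f (\<ominus> y) = \<ominus> f y"
    using left_ideal_homsD(4)[OF f, of "\<ominus> \<one>" y] y by simp
  then show ?thesis
    using left_ideal_homsD(3)[OF f x left_idealD(5)[OF A y]] by (simp add: a_minus_def)
qed

lemma finite_left_ideal_homs:
  assumes "finite A" "finite B"
  shows "finite (left_ideal_homs A B)"
  by (rule finite_subset[OF _ finite_PiE[OF assms(1), of "\<lambda>_. B"]])
    (use assms in \<open>auto simp: left_ideal_homs_def\<close>)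

lemma left_ideal_homs_eqI:
  assumes "f \<in> left_ideal_homs A B" "g \<in> left_ideal_homs A B" "\<And>x. x \<in> A \<Longrightarrow> f x = g x"
  shows "f = g"
  using assms left_ideal_homsD(2) by (meson extensionalityI)

lemma left_ideal_homs_compose:
  assumes A: "left_ideal A R" and f: "f \<in> left_ideal_homs A B" and g: "g \<in> left_ideal_homs B C"
  shows "compose A g f \<in> left_ideal_homs A C"
  using left_ideal_homsD[OF f] left_ideal_homsD[OF g] left_idealD[OF A]
  by (intro left_ideal_homsI) (auto simp: compose_def)

lemma left_ideal_homs_restrict:
  assumes A: "left_ideal A R" and "A \<subseteq> B" and f: "f \<in> left_ideal_homs B C"
    and "\<And>x. x \<in> A \<Longrightarrow> f x \<in> D"
  shows "restrict f A \<in> left_ideal_homs A D"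
  using left_ideal_homsD[OF f] left_idealD[OF A] assms(2,4)
  by (intro left_ideal_homsI) (auto simp: subset_iff)

lemma left_ideal_homs_image:
  assumes A: "left_ideal A R" and B: "left_ideal B R" and f: "f \<in> left_ideal_homs A B"
  shows "left_ideal (f ` A) R"
proof (rule left_idealI)
  note fD = left_ideal_homsD[OF f]
  show "f ` A \<subseteq> carrier R"
    using fD(1) left_idealD(1)[OF B] by auto
  show "\<zero> \<in> f ` A"
    using left_ideal_homs_zero[OF A B f] left_idealD(2)[OF A] by (metis imageI)
  fix u assume "u \<in> f ` A"
  then obtain x where x: "x \<in> A" "u = f x" by blast
  show "r \<otimes> u \<in> f ` A" if r: "r \<in> carrier R" for r
    using fD(4)[OF r x(1)] x left_idealD(4)[OF A r x(1)] by (metis imageI)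
  fix v assume "v \<in> f ` A"
  then obtain y where y: "y \<in> A" "v = f y" by blast
  show "u \<oplus> v \<in> f ` A"
    using fD(3)[OF x(1) y(1)] x y left_idealD(3)[OF A x(1) y(1)] by (metis imageI)
qed

lemma left_ideal_homs_kernel:
  assumes A: "left_ideal A R" and B: "left_ideal B R" and f: "f \<in> left_ideal_homs A B"
  shows "left_ideal {x \<in> A. f x = \<zero>} R"
  using left_ideal_homsD[OF f] left_idealD[OF A] left_ideal_homs_zero[OF A B f]
  by (intro left_idealI) auto

lemma left_ideal_homs_inj_onI:
  assumes A: "left_ideal A R" and B: "left_ideal B R" and f: "f \<in> left_ideal_homs A B"
    and ker: "\<And>x. x \<in> A \<Longrightarrow> f x = \<zero> \<Longrightarrow> x = \<zero>"
  shows "inj_on f A"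
proof (rule inj_onI)
  fix x y assume xy: "x \<in> A" "y \<in> A" "f x = f y"
  have fy: "f y \<in> carrier R"
    using left_idealD(1)[OF B] left_ideal_homsD(1)[OF f] xy by blast
  have "f (x \<ominus> y) = \<zero>"
    using left_ideal_homs_minus[OF A B f xy(1,2)] xy(3) fy by simp
  then have "x \<ominus> y = \<zero>"
    using ker left_idealD(6)[OF A] xy by blast
  then show "x = y"
    using xy left_idealD(1)[OF A] by simp
qed

lemma left_ideal_homs_inverse:
  assumes A: "left_ideal A R" and f: "f \<in> left_ideal_homs A B" and bij: "bij_betw f A B"
  shows "restrict (inv_into A f) B \<in> left_ideal_homs B A"
proof (rule left_ideal_homsI)
  note fD = left_ideal_homsD[OF f] and AD = left_idealD[OF A]
  let ?g = "inv_into A f"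
  have g: "?g u \<in> A" "f (?g u) = u" if "u \<in> B" for u
    using that bij by (auto simp: bij_betw_def inv_into_into f_inv_into_f)
  have gf: "?g (f x) = x" if "x \<in> A" for x
    using that bij by (simp add: bij_betw_def)
  show "restrict ?g B u \<in> A" if "u \<in> B" for u
    using that g by simp
  show "restrict ?g B (u \<oplus> v) = restrict ?g B u \<oplus> restrict ?g B v" if u: "u \<in> B" and v: "v \<in> B" for u v
  proof -
    have "f (?g u \<oplus> ?g v) = u \<oplus> v"
      using fD(3) g u v by simp
    then show ?thesis
      using gf[of "?g u \<oplus> ?g v"] fD(1)[of "?g u \<oplus> ?g v"] AD(3) g u v by simp
  qed
  show "restrict ?g B (r \<otimes> u) = r \<otimes> restrict ?g B u" if r: "r \<in> carrier R" and u: "u \<in> B" for r u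
  proof -
    have "f (r \<otimes> ?g u) = r \<otimes> u"
      using fD(4) g u r by simp
    then show ?thesis
      using gf[of "r \<otimes> ?g u"] fD(1)[of "r \<otimes> ?g u"] AD(4) g u r by simp
  qed
qed simp

section \<open>Homomorphisms into and out of a direct sum\<close>

lemma direct_sum_projections:
  assumes A: "left_ideal A R" and B: "left_ideal B R" and AB: "A \<inter> B = {\<zero>}"
  obtains p q where "p \<in> left_ideal_homs (A <+> B) A" "q \<in> left_ideal_homs (A <+> B) B"
    "\<And>x. x \<in> A <+> B \<Longrightarrow> p x \<oplus> q x = x"
    "\<And>a b. a \<in> A \<Longrightarrow> b \<in> B \<Longrightarrow> p (a \<oplus> b) = a \<and> q (a \<oplus> b) = b"
proof -
  note AD = left_idealD[OF A] and BD = left_idealD[OF B]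
  note uniq = direct_sum_unique[OF A B AB]
  define p where "p = (\<lambda>x\<in>A <+> B. SOME a. a \<in> A \<and> (\<exists>b\<in>B. x = a \<oplus> b))"
  define q where "q = (\<lambda>x\<in>A <+> B. SOME b. b \<in> B \<and> (\<exists>a\<in>A. x = a \<oplus> b))"
  have sum: "a \<oplus> b \<in> A <+> B" if "a \<in> A" "b \<in> B" for a b
    using that mem_set_add_iff by blast
  have p: "p (a \<oplus> b) = a" and q: "q (a \<oplus> b) = b" if ab: "a \<in> A" "b \<in> B" for a b
  proof -
    have "(SOME a'. a' \<in> A \<and> (\<exists>b'\<in>B. a \<oplus> b = a' \<oplus> b')) = a"
      by (rule some_equality) (use ab uniq in blast)+
    moreover have "(SOME b'. b' \<in> B \<and> (\<exists>a'\<in>A. a \<oplus> b = a' \<oplus> b')) = b"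
      by (rule some_equality) (use ab uniq in blast)+
    ultimately show "p (a \<oplus> b) = a" "q (a \<oplus> b) = b"
      using sum[OF ab] by (simp_all add: p_def q_def)
  qed
  have add: "(a \<oplus> b) \<oplus> (c \<oplus> d) = (a \<oplus> c) \<oplus> (b \<oplus> d)" if "a \<in> A" "b \<in> B" "c \<in> A" "d \<in> B" for a b c d
    using that AD(1) BD(1) by (simp add: a_ac)
  have smult: "r \<otimes> (a \<oplus> b) = (r \<otimes> a) \<oplus> (r \<otimes> b)" if "a \<in> A" "b \<in> B" "r \<in> carrier R" for a b r
    using that AD(1) BD(1) by (simp add: r_distr)
  have "p \<in> left_ideal_homs (A <+> B) A"
  proof (rule left_ideal_homsI)
    show "p \<in> extensional (A <+> B)" by (simp add: p_def)
    fix x :: 'a assume "x \<in> A <+> B"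
    then obtain a b where x: "a \<in> A" "b \<in> B" "x = a \<oplus> b"
      unfolding mem_set_add_iff by blast
    show "p x \<in> A"
      using x p by simp
    show "p (r \<otimes> x) = r \<otimes> p x" if "r \<in> carrier R" for r
      using x p that AD(4) BD(4) by (simp add: smult)
    fix y :: 'a assume "y \<in> A <+> B"
    then obtain c d where y: "c \<in> A" "d \<in> B" "y = c \<oplus> d"
      unfolding mem_set_add_iff by blast
    show "p (x \<oplus> y) = p x \<oplus> p y"
      using add[OF x(1,2) y(1,2)] p[OF AD(3)[OF x(1) y(1)] BD(3)[OF x(2) y(2)]]
        p[OF x(1,2)] p[OF y(1,2)] x(3) y(3) by metis
  qed
  moreover have "q \<in> left_ideal_homs (A <+> B) B"
  proof (rule left_ideal_homsI)
    show "q \<in> extensional (A <+> B)" by (simp add: q_def)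
    fix x :: 'a assume "x \<in> A <+> B"
    then obtain a b where x: "a \<in> A" "b \<in> B" "x = a \<oplus> b"
      unfolding mem_set_add_iff by blast
    show "q x \<in> B"
      using x q by simp
    show "q (r \<otimes> x) = r \<otimes> q x" if "r \<in> carrier R" for r
      using x q that AD(4) BD(4) by (simp add: smult)
    fix y :: 'a assume "y \<in> A <+> B"
    then obtain c d where y: "c \<in> A" "d \<in> B" "y = c \<oplus> d"
      unfolding mem_set_add_iff by blast
    show "q (x \<oplus> y) = q x \<oplus> q y"
      using add[OF x(1,2) y(1,2)] q[OF AD(3)[OF x(1) y(1)] BD(3)[OF x(2) y(2)]]
        q[OF x(1,2)] q[OF y(1,2)] x(3) y(3) by metis
  qed
  moreover have "p x \<oplus> q x = x" if "x \<in> A <+> B" for x :: 'a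
    using that p q unfolding mem_set_add_iff by auto
  ultimately show ?thesis
    using that p q by blast
qed

text \<open>Composing with the two projections splits a homomorphism into its components, and
  pointwise addition reassembles them.\<close>

lemma card_left_ideal_homs_set_add_right:
  assumes A: "left_ideal A R" and B: "left_ideal B R" and AB: "A \<inter> B = {\<zero>}" and M: "left_ideal M R"
  shows "card (left_ideal_homs M (A <+> B)) = card (left_ideal_homs M A) * card (left_ideal_homs M B)"
proof -
  obtain p q where p: "p \<in> left_ideal_homs (A <+> B) A" and q: "q \<in> left_ideal_homs (A <+> B) B"
    and pq: "\<And>x. x \<in> A <+> B \<Longrightarrow> p x \<oplus> q x = x"
    and sum: "\<And>a b. a \<in> A \<Longrightarrow> b \<in> B \<Longrightarrow> p (a \<oplus> b) = a \<and> q (a \<oplus> b) = b"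
    by (rule direct_sum_projections[OF A B AB]) blast
  note AD = left_idealD[OF A] and BD = left_idealD[OF B] and MD = left_idealD[OF M]
  let ?P = "left_ideal_homs M A \<times> left_ideal_homs M B"
  have "bij_betw (\<lambda>h. (compose M p h, compose M q h)) (left_ideal_homs M (A <+> B)) ?P"
  proof (rule bij_betwI[where g = "\<lambda>(f, g). \<lambda>x\<in>M. f x \<oplus> g x"])
    show "(\<lambda>h. (compose M p h, compose M q h)) \<in> left_ideal_homs M (A <+> B) \<rightarrow> ?P"
      using left_ideal_homs_compose[OF M _ p] left_ideal_homs_compose[OF M _ q] by auto
    show "(\<lambda>(f, g). \<lambda>x\<in>M. f x \<oplus> g x) \<in> ?P \<rightarrow> left_ideal_homs M (A <+> B)"
    proof clarify
      fix f g assume f: "f \<in> left_ideal_homs M A" and g: "g \<in> left_ideal_homs M B"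
      note fD = left_ideal_homsD[OF f] and gD = left_ideal_homsD[OF g]
      have c: "f x \<in> carrier R" "g x \<in> carrier R" if "x \<in> M" for x
        using that fD(1) gD(1) AD(1) BD(1) by auto
      show "(\<lambda>x\<in>M. f x \<oplus> g x) \<in> left_ideal_homs M (A <+> B)"
      proof (rule left_ideal_homsI)
        show "(\<lambda>x\<in>M. f x \<oplus> g x) x \<in> A <+> B" if "x \<in> M" for x
          using that fD(1) gD(1) unfolding mem_set_add_iff by auto
      qed (use fD(3,4) gD(3,4) MD c in \<open>auto simp: a_ac r_distr\<close>)
    qed
    show "(\<lambda>(f, g). \<lambda>x\<in>M. f x \<oplus> g x) (compose M p h, compose M q h) = h"
      if h: "h \<in> left_ideal_homs M (A <+> B)" for h
      using left_ideal_homsD(1,2)[OF h] pq by (auto simp: compose_def extensional_def fun_eq_iff)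
    show "(\<lambda>h. (compose M p h, compose M q h)) ((\<lambda>(f, g). \<lambda>x\<in>M. f x \<oplus> g x) fg) = fg" if fg: "fg \<in> ?P" for fg
    proof -
      obtain f g where fg': "fg = (f, g)" "f \<in> left_ideal_homs M A" "g \<in> left_ideal_homs M B"
        using fg by auto
      then show ?thesis
        using left_ideal_homsD(1,2)[OF fg'(2)] left_ideal_homsD(1,2)[OF fg'(3)] sum
        by (auto simp: compose_def extensional_def fun_eq_iff)
    qed
  qed
  from bij_betw_same_card[OF this] show ?thesis
    by (simp add: card_cartesian_product)
qed

text \<open>A homomorphism is recovered from its restrictions to the summands by projecting first
  and adding afterwards.\<close>

lemma card_left_ideal_homs_set_add_left:
  assumes A: "left_ideal A R" and B: "left_ideal B R" and AB: "A \<inter> B = {\<zero>}" and M: "left_ideal M R"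
  shows "card (left_ideal_homs (A <+> B) M) = card (left_ideal_homs A M) * card (left_ideal_homs B M)"
proof -
  obtain p q where p: "p \<in> left_ideal_homs (A <+> B) A" and q: "q \<in> left_ideal_homs (A <+> B) B"
    and pq: "\<And>x. x \<in> A <+> B \<Longrightarrow> p x \<oplus> q x = x"
    and sum: "\<And>a b. a \<in> A \<Longrightarrow> b \<in> B \<Longrightarrow> p (a \<oplus> b) = a \<and> q (a \<oplus> b) = b"
    by (rule direct_sum_projections[OF A B AB]) blast
  note pD = left_ideal_homsD[OF p] and qD = left_ideal_homsD[OF q]
  note AD = left_idealD[OF A] and BD = left_idealD[OF B] and MD = left_idealD[OF M]
  note ABD = left_idealD[OF left_ideal_set_add[OF A B]]
  note upper = set_add_upper[OF A B]
  let ?P = "left_ideal_homs A M \<times> left_ideal_homs B M"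
  let ?g = "\<lambda>(f, g). \<lambda>x\<in>A <+> B. f (p x) \<oplus> g (q x)"
  have "bij_betw (\<lambda>h. (restrict h A, restrict h B)) (left_ideal_homs (A <+> B) M) ?P"
  proof (rule bij_betwI[where g = ?g])
    show "(\<lambda>h. (restrict h A, restrict h B)) \<in> left_ideal_homs (A <+> B) M \<rightarrow> ?P"
    proof
      fix h assume h: "h \<in> left_ideal_homs (A <+> B) M"
      have "h x \<in> M" "h y \<in> M" if "x \<in> A" "y \<in> B" for x y
        using left_ideal_homsD(1)[OF h] upper that by auto
      then have "restrict h A \<in> left_ideal_homs A M" "restrict h B \<in> left_ideal_homs B M"
        using left_ideal_homs_restrict[OF A upper(1) h] left_ideal_homs_restrict[OF B upper(2) h]
          AD(2) BD(2) by auto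
      then show "(restrict h A, restrict h B) \<in> ?P"
        by blast
    qed
    show "?g \<in> ?P \<rightarrow> left_ideal_homs (A <+> B) M"
    proof clarify
      fix f g assume f: "f \<in> left_ideal_homs A M" and g: "g \<in> left_ideal_homs B M"
      note fD = left_ideal_homsD[OF f] and gD = left_ideal_homsD[OF g]
      have c: "f x \<in> carrier R" if "x \<in> A" for x
        using that fD(1) MD(1) by auto
      have c': "g x \<in> carrier R" if "x \<in> B" for x
        using that gD(1) MD(1) by auto
      show "(\<lambda>x\<in>A <+> B. f (p x) \<oplus> g (q x)) \<in> left_ideal_homs (A <+> B) M"
        by (rule left_ideal_homsI)
          (use fD gD MD(3) ABD pD qD c c' in \<open>auto simp: a_ac r_distr\<close>)
    qed
    show "?g (restrict h A, restrict h B) = h" if h: "h \<in> left_ideal_homs (A <+> B) M" for h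
    proof -
      have "h (p x) \<oplus> h (q x) = h x" if x: "x \<in> A <+> B" for x :: 'a
        using left_ideal_homsD(3)[OF h, of "p x" "q x"] pq[OF x] pD(1)[OF x] qD(1)[OF x] upper
        by (metis subsetD)
      then show ?thesis
        using left_ideal_homsD(2)[OF h] pD(1) qD(1) by (auto simp: extensional_def fun_eq_iff)
    qed
    show "(\<lambda>h. (restrict h A, restrict h B)) (?g fg) = fg" if fg: "fg \<in> ?P" for fg
    proof -
      obtain f g where fg': "fg = (f, g)" and f: "f \<in> left_ideal_homs A M" and g: "g \<in> left_ideal_homs B M"
        using fg by auto
      have "p a = a \<and> q a = \<zero>" if "a \<in> A" for a
        using sum[OF that BD(2)] AD(1)[OF that] by simp
      moreover have "p b = \<zero> \<and> q b = b" if "b \<in> B" for b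
        using sum[OF AD(2) that] BD(1)[OF that] by simp
      moreover have "f a \<in> carrier R" if "a \<in> A" for a
        using that left_ideal_homsD(1)[OF f] MD(1) by auto
      moreover have "g b \<in> carrier R" if "b \<in> B" for b
        using that left_ideal_homsD(1)[OF g] MD(1) by auto
      ultimately show ?thesis
        using left_ideal_homsD(2)[OF f] left_ideal_homsD(2)[OF g] upper AD(2) BD(2)
          left_ideal_homs_zero[OF A M f] left_ideal_homs_zero[OF B M g]
        by (auto simp: fg' extensional_def fun_eq_iff subset_iff)
    qed
  qed
  from bij_betw_same_card[OF this] show ?thesis
    by (simp add: card_cartesian_product)
qed

section \<open>Schur's lemma and the symmetry of the Hom counts\<close>

lemma schur_bij_betw:
  assumes M: "minimal_left_ideal M R" and N: "minimal_left_ideal N R"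
    and f: "f \<in> left_ideal_homs M N" and nz: "x \<in> M" "f x \<noteq> \<zero>"
  shows "bij_betw f M N"
proof -
  note MD = minimal_left_idealD[OF M] and ND = minimal_left_idealD[OF N]
  have "{x \<in> M. f x = \<zero>} = {\<zero>}"
    using MD(3)[OF left_ideal_homs_kernel[OF MD(1) ND(1) f]] nz by blast
  then have "inj_on f M"
    by (intro left_ideal_homs_inj_onI[OF MD(1) ND(1) f]) blast
  moreover have "f ` M = N"
    using ND(3)[OF left_ideal_homs_image[OF MD(1) ND(1) f]] left_ideal_homsD(1)[OF f] nz by blast
  ultimately show ?thesis
    by (simp add: bij_betw_def)
qed

text \<open>A nonzero \<open>f\<close> from \<open>M\<close> to \<open>N\<close> has an inverse
  \<open>g\<close> by Schur's lemma, and sending \<open>\<phi>\<close> to \<open>g \<phi> g\<close>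
  is injective because \<open>f\<close> undoes it on both sides. If every homomorphism from
  \<open>M\<close> to \<open>N\<close> is zero, there is only one, and the zero map exists in the
  other direction as well. Exchanging \<open>M\<close> and \<open>N\<close> turns the inequality
  into an equality.\<close>

lemma card_left_ideal_homs_minimal_le:
  assumes M: "minimal_left_ideal M R" "finite M" and N: "minimal_left_ideal N R" "finite N"
  shows "card (left_ideal_homs M N) \<le> card (left_ideal_homs N M)"
proof (cases "\<exists>f\<in>left_ideal_homs M N. \<exists>x\<in>M. f x \<noteq> \<zero>")
  case True
  note MD = minimal_left_idealD[OF M(1)] and ND = minimal_left_idealD[OF N(1)]
  obtain f where f: "f \<in> left_ideal_homs M N" "bij_betw f M N"
    using True schur_bij_betw[OF M(1) N(1)] by blast
  define g where "g = restrict (inv_into M f) N"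
  have g: "g \<in> left_ideal_homs N M"
    unfolding g_def by (rule left_ideal_homs_inverse[OF MD(1) f])
  have gf: "g (f x) = x" "f x \<in> N" if "x \<in> M" for x
    using that f left_ideal_homsD(1)[OF f(1)] by (auto simp: g_def bij_betw_def)
  have fg: "f (g y) = y" "g y \<in> M" if "y \<in> N" for y
    using that f(2) left_ideal_homsD(1)[OF g] by (auto simp: g_def bij_betw_def f_inv_into_f)
  show ?thesis
  proof (rule card_inj_on_le[OF _ _ finite_left_ideal_homs[OF N(2) M(2)]])
    show "inj_on (\<lambda>\<phi>. compose N g (compose N \<phi> g)) (left_ideal_homs M N)"
    proof (rule inj_onI)
      fix \<phi> \<psi> assume phi: "\<phi> \<in> left_ideal_homs M N" and psi: "\<psi> \<in> left_ideal_homs M N"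
        and eq: "compose N g (compose N \<phi> g) = compose N g (compose N \<psi> g)"
      show "\<phi> = \<psi>"
      proof (rule left_ideal_homs_eqI[OF phi psi])
        fix x assume x: "x \<in> M"
        have "compose N g (compose N \<phi> g) (f x) = g (\<phi> x)" "compose N g (compose N \<psi> g) (f x) = g (\<psi> x)"
          using gf[OF x] by (simp_all add: compose_def)
        then have "f (g (\<phi> x)) = f (g (\<psi> x))"
          using eq by simp
        then show "\<phi> x = \<psi> x"
          using fg(1) left_ideal_homsD(1)[OF phi x] left_ideal_homsD(1)[OF psi x] by simp
      qed
    qed
    show "(\<lambda>\<phi>. compose N g (compose N \<phi> g)) ` left_ideal_homs M N \<subseteq> left_ideal_homs N M"
      using left_ideal_homs_compose[OF ND(1)] g by blast
  qed
next
  case False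
  note MD = minimal_left_idealD[OF M(1)] and ND = minimal_left_idealD[OF N(1)]
  have "(\<lambda>x\<in>N. \<zero>) \<in> left_ideal_homs N M"
    using left_idealD[OF MD(1)] left_idealD[OF ND(1)] by (intro left_ideal_homsI) auto
  then have "card (left_ideal_homs N M) > 0"
    using finite_left_ideal_homs[OF N(2) M(2)] card_gt_0_iff by blast
  moreover have "\<forall>f\<in>left_ideal_homs M N. \<forall>g\<in>left_ideal_homs M N. f = g"
    using False left_ideal_homs_eqI by metis
  then have "card (left_ideal_homs M N) \<le> 1"
    using card_le_Suc0_iff_eq[OF finite_left_ideal_homs[OF M(2) N(2)]] by simp
  ultimately show ?thesis by linarith
qed

text \<open>Direct sums of finitely many finite minimal left ideals, presented as a chain: the
  induction rule adds a single summand, which is the form of both criteria below.\<close>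

inductive finite_semisimple :: "'a set \<Rightarrow> bool"
  where zero: "finite_semisimple {\<zero>}"
  | add: "finite_semisimple A \<Longrightarrow> minimal_left_ideal M R \<Longrightarrow> finite M \<Longrightarrow> A \<inter> M = {\<zero>} \<Longrightarrow>
      finite_semisimple (A <+> M)"

lemma finite_semisimple_left_ideal: "finite_semisimple A \<Longrightarrow> left_ideal A R \<and> finite A"
proof (induction rule: finite_semisimple.induct)
  case (add A M)
  have "finite (A <+>\<^bsub>R\<^esub> M)"
    using add by (auto simp: set_add_def')
  then show ?case
    using add left_ideal_set_add minimal_left_idealD(1) by blast
qed (simp add: left_ideal_zero)

text \<open>Both counts are multiplicative over direct sums in \<open>A\<close>. This reduces the
  claim to one minimal summand \<open>N\<close>, where the inequalities for \<open>N\<close>,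
  \<open>M\<close> and for \<open>M\<close>, \<open>N\<close> combine.\<close>

lemma card_left_ideal_homs_semisimple:
  assumes "finite_semisimple A" and M: "minimal_left_ideal M R" "finite M"
  shows "card (left_ideal_homs A M) = card (left_ideal_homs M A)"
  using assms(1)
proof (induction rule: finite_semisimple.induct)
  case zero
  note MD = left_idealD[OF minimal_left_idealD(1)[OF M(1)]]
  have "left_ideal_homs {\<zero>} M = {\<lambda>x\<in>{\<zero>}. \<zero>}"
  proof (intro equalityI subsetI)
    fix f assume f: "f \<in> left_ideal_homs {\<zero>} M"
    then have "f \<zero> = \<zero>"
      using left_ideal_homs_zero[OF left_ideal_zero minimal_left_idealD(1)[OF M(1)]] by blast
    then show "f \<in> {\<lambda>x\<in>{\<zero>}. \<zero>}"
      using left_ideal_homsD(2)[OF f] by (auto simp: extensional_def)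
  qed (use MD(2) in \<open>auto intro!: left_ideal_homsI\<close>)
  moreover have "left_ideal_homs M {\<zero>} = {\<lambda>x\<in>M. \<zero>}"
  proof (intro equalityI subsetI)
    fix f assume f: "f \<in> left_ideal_homs M {\<zero>}"
    then show "f \<in> {\<lambda>x\<in>M. \<zero>}"
      using left_ideal_homsD(1,2)[OF f] by (auto simp: extensional_def)
  qed (use MD in \<open>auto intro!: left_ideal_homsI\<close>)
  ultimately show ?case by simp
next
  case (add A N)
  have A: "left_ideal A R" and N: "left_ideal N R" and MI: "left_ideal M R"
    using add M finite_semisimple_left_ideal minimal_left_idealD(1) by auto
  have "card (left_ideal_homs N M) = card (left_ideal_homs M N)"
    using card_left_ideal_homs_minimal_le add M by (meson le_antisym)
  then show ?case
    using add.IH card_left_ideal_homs_set_add_left[OF A N add.hyps(4) MI]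
      card_left_ideal_homs_set_add_right[OF A N add.hyps(4) MI] by simp
qed

end

section \<open>Cyclic left ideals and torsion-free characters\<close>

context ring
begin

abbreviation left_ideal_characters :: "'a set \<Rightarrow> ('a \<Rightarrow> complex) set"
  where "left_ideal_characters \<equiv> subgroup_characters (add_monoid R)"

definition cyclic_left_ideal :: "'a set \<Rightarrow> bool"
  where "cyclic_left_ideal A \<longleftrightarrow> (\<exists>a\<in>A. A = (\<lambda>r. r \<otimes> a) ` carrier R)"

text \<open>Finitary torsion-freeness inside \<open>A\<close>. Finiteness of \<open>N\<close> is
  implicit, as it follows from \<open>N \<subseteq> A\<close> for the finite \<open>A\<close> to
  which this is applied.\<close>

definition torsion_free_character :: "'a set \<Rightarrow> ('a \<Rightarrow> complex) \<Rightarrow> bool"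
  where "torsion_free_character A \<chi> \<longleftrightarrow> \<chi> \<in> left_ideal_characters A \<and>
    (\<forall>N. left_ideal N R \<longrightarrow> N \<subseteq> A \<longrightarrow> (\<forall>x\<in>N. \<chi> x = 1) \<longrightarrow> N = {\<zero>})"

lemma left_ideal_charactersD:
  assumes A: "left_ideal A R" and chi: "\<chi> \<in> left_ideal_characters A"
  shows "x \<in> A \<Longrightarrow> \<chi> x \<noteq> 0" "x \<in> A \<Longrightarrow> cmod (\<chi> x) = 1"
    "x \<in> A \<Longrightarrow> y \<in> A \<Longrightarrow> \<chi> (x \<oplus> y) = \<chi> x * \<chi> y" "\<chi> \<zero> = 1"
    "x \<in> A \<Longrightarrow> y \<in> A \<Longrightarrow> \<chi> (x \<ominus> y) = \<chi> x / \<chi> y"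
proof -
  note AD = left_idealD[OF A]
  show n: "x \<in> A \<Longrightarrow> cmod (\<chi> x) = 1" for x
    using chi by (simp add: subgroup_characters_iff)
  then show nz: "x \<in> A \<Longrightarrow> \<chi> x \<noteq> 0" for x
    by force
  show add: "x \<in> A \<Longrightarrow> y \<in> A \<Longrightarrow> \<chi> (x \<oplus> y) = \<chi> x * \<chi> y" for x y
    using chi by (simp add: subgroup_characters_iff)
  show "\<chi> \<zero> = 1"
    using add[OF AD(2) AD(2)] nz[OF AD(2)] by simp
  assume x: "x \<in> A" and y: "y \<in> A"
  have "x \<ominus> y \<oplus> y = x"
    using AD(1) x y by (simp add: a_minus_def a_assoc l_neg)
  then show "\<chi> (x \<ominus> y) = \<chi> x / \<chi> y"
    using add[OF AD(6)[OF x y] y] nz[OF y] by (simp add: field_simps)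
qed

lemma left_ideal_charactersI:
  assumes "\<chi> \<in> extensional A" "\<And>x. x \<in> A \<Longrightarrow> cmod (\<chi> x) = 1"
    "\<And>x y. x \<in> A \<Longrightarrow> y \<in> A \<Longrightarrow> \<chi> (x \<oplus> y) = \<chi> x * \<chi> y"
  shows "\<chi> \<in> left_ideal_characters A"
  using assms by (simp add: subgroup_characters_iff)

lemma card_left_ideal_characters:
  assumes M: "left_ideal M R" and fin: "finite M"
  shows "finite (left_ideal_characters M)" "card (left_ideal_characters M) = card M"
proof -
  have "subgroup M (add_monoid R)"
    using M left_ideal.axioms(1) additive_subgroup.a_subgroup by blast
  then interpret M: group "add_monoid R\<lparr>carrier := M\<rparr>"
    by (rule add.subgroup_imp_group)
  interpret M: comm_group "add_monoid R\<lparr>carrier := M\<rparr>"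
    by (rule M.group_comm_groupI) (simp add: a_comm left_idealD(1)[OF M])
  have "subgroup_characters (add_monoid R\<lparr>carrier := M\<rparr>) M = left_ideal_characters M"
    by (simp add: subgroup_characters_def)
  then show "finite (left_ideal_characters M)" "card (left_ideal_characters M) = card M"
    using M.card_subgroup_characters fin by simp_all
qed

text \<open>The left ideal generated by \<open>a\<close> is \<open>R\<close> modulo the annihilator
  of \<open>a\<close>, and \<open>ann\<close> lets right multiplication by \<open>m\<close> factor
  through this quotient.\<close>

lemma exists_hom_from_cyclic:
  assumes a: "a \<in> carrier R" and M: "left_ideal M R" and m: "m \<in> M"
    and ann: "\<And>r. r \<in> carrier R \<Longrightarrow> r \<otimes> a = \<zero> \<Longrightarrow> r \<otimes> m = \<zero>"
  obtains h where "h \<in> left_ideal_homs ((\<lambda>r. r \<otimes> a) ` carrier R) M" "h a = m"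
proof -
  let ?A = "(\<lambda>r. r \<otimes> a) ` carrier R"
  have mc: "m \<in> carrier R"
    using left_idealD(1)[OF M m] .
  define h where "h = (\<lambda>x\<in>?A. (SOME r. r \<in> carrier R \<and> x = r \<otimes> a) \<otimes> m)"
  have h: "h (r \<otimes> a) = r \<otimes> m" if r: "r \<in> carrier R" for r
  proof -
    define s where "s = (SOME s. s \<in> carrier R \<and> r \<otimes> a = s \<otimes> a)"
    have s: "s \<in> carrier R" "r \<otimes> a = s \<otimes> a"
      unfolding s_def using someI[of "\<lambda>s. s \<in> carrier R \<and> r \<otimes> a = s \<otimes> a" r] r by auto
    have "(s \<ominus> r) \<otimes> a = \<zero>"
      using s r a by (simp add: a_minus_def l_distr l_minus r_neg)
    then have "(s \<ominus> r) \<otimes> m = \<zero>"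
      using ann s r by simp
    then have "s \<otimes> m = r \<otimes> m"
      using s r mc by (simp add: a_minus_def l_distr l_minus minus_equality add.inv_solve_right' )
    then show ?thesis
      using r by (simp add: h_def s_def)
  qed
  have "h \<in> left_ideal_homs ?A M"
  proof (rule left_ideal_homsI)
    show "h \<in> extensional ?A"
      by (simp add: h_def)
    fix x assume "x \<in> ?A"
    then obtain r where r: "r \<in> carrier R" "x = r \<otimes> a" by blast
    show "h x \<in> M"
      using h r left_idealD(4)[OF M _ m] by simp
    show "h (s \<otimes> x) = s \<otimes> h x" if s: "s \<in> carrier R" for s
      using h[of "s \<otimes> r"] h[of r] r s a mc by (simp add: m_assoc)
    fix y assume "y \<in> ?A"
    then obtain s where s: "s \<in> carrier R" "y = s \<otimes> a" by blast
    show "h (x \<oplus> y) = h x \<oplus> h y"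
      using h[of "r \<oplus> s"] h[of r] h[of s] r s a mc by (simp add: l_distr)
  qed
  moreover have "h a = m"
    using h[of \<one>] a mc by simp
  ultimately show ?thesis
    using that by blast
qed

text \<open>Evaluation at a generator \<open>a\<close> embeds \<open>Hom(A, M)\<close> into
  \<open>M\<close>. Its image consists of the \<open>m\<close> for which \<open>a \<oplus> m\<close>
  does not generate the sum, since the multiples of \<open>a \<oplus> m\<close> then stay on the
  graph of a homomorphism. The strict inequality says that some \<open>m\<close> lies outside the
  image.\<close>

lemma cyclic_set_add_iff:
  assumes A: "left_ideal A R" "finite A" and M: "minimal_left_ideal M R" "finite M"
    and AM: "A \<inter> M = {\<zero>}"
  shows "cyclic_left_ideal (A <+> M) \<longleftrightarrow>
    cyclic_left_ideal A \<and> card (left_ideal_homs A M) < card M" (is "?L \<longleftrightarrow> ?R")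
proof
  note MD = minimal_left_idealD[OF M(1)]
  note AD' = left_idealD[OF A(1)] and MD' = left_idealD[OF MD(1)]
  note uniq = direct_sum_unique[OF A(1) MD(1) AM]
  note upper = set_add_upper[OF A(1) MD(1)]
  have finH: "finite (left_ideal_homs A M)"
    by (rule finite_left_ideal_homs[OF A(2) M(2)])
  {
    assume ?L
    then obtain s :: 'a where s: "s \<in> A <+> M" "A <+> M = (\<lambda>r. r \<otimes> s) ` carrier R"
      unfolding cyclic_left_ideal_def by blast
    obtain a m where am: "a \<in> A" "m \<in> M" "s = a \<oplus> m"
      using s(1) unfolding mem_set_add_iff by blast
    have rs: "r \<otimes> s = r \<otimes> a \<oplus> r \<otimes> m" if "r \<in> carrier R" for r
      using that am AD'(1) MD'(1) by (simp add: r_distr)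
    \<comment> \<open>Comparing the \<open>A\<close>-components of \<open>x = r \<otimes> s\<close>
      shows that \<open>a\<close> alone generates \<open>A\<close>.\<close>
    have gen: "\<exists>r\<in>carrier R. x = r \<otimes> a" if x: "x \<in> A" for x
    proof -
      obtain r where r: "r \<in> carrier R" "x = r \<otimes> s"
        using x upper(1) s(2) by blast
      have "x \<oplus> \<zero> = r \<otimes> a \<oplus> r \<otimes> m"
        using r rs AD'(1)[OF x] by simp
      then have "x = r \<otimes> a"
        using uniq(1)[OF x AD'(4)[OF r(1) am(1)] MD'(2) MD'(4)[OF r(1) am(2)]] by simp
      then show ?thesis
        using r by blast
    qed
    have "A = (\<lambda>r. r \<otimes> a) ` carrier R"
      using gen principal_subset[OF A(1) am(1)] by auto
    then have "cyclic_left_ideal A"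
      unfolding cyclic_left_ideal_def using am(1) by blast
    have inj: "inj_on (\<lambda>h. h a) (left_ideal_homs A M)"
    proof (rule inj_onI)
      fix h h' assume h: "h \<in> left_ideal_homs A M" "h' \<in> left_ideal_homs A M" "h a = h' a"
      show "h = h'"
      proof (rule left_ideal_homs_eqI[OF h(1,2)])
        fix x assume "x \<in> A"
        then obtain r where "r \<in> carrier R" "x = r \<otimes> a"
          using gen by blast
        then show "h x = h' x"
          using left_ideal_homsD(4)[OF h(1) _ am(1)] left_ideal_homsD(4)[OF h(2) _ am(1)] h(3) by simp
      qed
    qed
    have "h a \<noteq> m" if h: "h \<in> left_ideal_homs A M" for h
    proof
      assume eq: "h a = m"
      \<comment> \<open>An element of \<open>M\<close> has the form \<open>r \<otimes> s\<close>
        with \<open>r \<otimes> a = \<zero>\<close>; it then equals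
        \<open>r \<otimes> m = h (r \<otimes> a)\<close> and vanishes.\<close>
      have "M \<subseteq> {\<zero>}"
      proof
        fix y assume y: "y \<in> M"
        obtain r where r: "r \<in> carrier R" "y = r \<otimes> s"
          using y upper(2) s(2) by blast
        have "\<zero> \<oplus> y = r \<otimes> a \<oplus> r \<otimes> m"
          using r rs MD'(1)[OF y] by simp
        then have ra: "\<zero> = r \<otimes> a" "y = r \<otimes> m"
          using uniq[OF AD'(2) AD'(4)[OF r(1) am(1)] y MD'(4)[OF r(1) am(2)]] by simp_all
        have "r \<otimes> m = h (r \<otimes> a)"
          using left_ideal_homsD(4)[OF h r(1) am(1)] eq by simp
        also have "\<dots> = \<zero>"
          using ra(1) left_ideal_homs_zero[OF A(1) MD(1) h] by simp
        finally show "y \<in> {\<zero>}"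
          using ra(2) by simp
      qed
      then show False
        using MD(2) MD'(2) by blast
    qed
    then have "(\<lambda>h. h a) ` left_ideal_homs A M \<subseteq> M - {m}"
      using am(1) by (auto dest: left_ideal_homsD(1))
    then have "(\<lambda>h. h a) ` left_ideal_homs A M \<subset> M"
      using am(2) by blast
    then have "card (left_ideal_homs A M) < card M"
      using psubset_card_mono[OF M(2)] card_image[OF inj] by metis
    then show ?R
      using \<open>cyclic_left_ideal A\<close> by blast
  next
    assume R: ?R
    then obtain a where a: "a \<in> A" "A = (\<lambda>r. r \<otimes> a) ` carrier R"
      unfolding cyclic_left_ideal_def by blast
    have "card ((\<lambda>h. h a) ` left_ideal_homs A M) < card M"
      using R card_image_le[OF finH, of "\<lambda>h. h a"] by linarith
    then obtain m where m: "m \<in> M" "m \<notin> (\<lambda>h. h a) ` left_ideal_homs A M"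
      using card_mono[OF finite_imageI[OF finH], of M "\<lambda>h. h a"] by (meson not_less subsetI)
    define s where "s = a \<oplus> m"
    have c: "a \<in> carrier R" "m \<in> carrier R" "s \<in> carrier R"
      using a m AD'(1) MD'(1) by (auto simp: s_def)
    have s: "s \<in> A <+> M"
      unfolding s_def mem_set_add_iff using a(1) m(1) by blast
    let ?P = "(\<lambda>r. r \<otimes> s) ` carrier R"
    note P = left_ideal_principal[OF c(3)]
    \<comment> \<open>By minimality \<open>M\<close> is contained in \<open>?P\<close> or meets it
      in zero only. In the second case whatever kills \<open>a\<close> also kills \<open>m\<close>,
      because \<open>r \<otimes> m = r \<otimes> s\<close> lies in both; some homomorphism would
      then send \<open>a\<close> to \<open>m\<close>, against the choice of
      \<open>m\<close>.\<close>
    have "M \<subseteq> ?P"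
    proof (rule ccontr)
      assume "\<not> M \<subseteq> ?P"
      then have PM: "?P \<inter> M = {\<zero>}"
        using MD(3)[OF left_ideal_Int[OF P MD(1)]] by blast
      have "r \<otimes> m = \<zero>" if r: "r \<in> carrier R" "r \<otimes> a = \<zero>" for r
      proof -
        have "r \<otimes> s = r \<otimes> m"
          using r c by (simp add: s_def r_distr)
        then have "r \<otimes> m \<in> ?P \<inter> M"
          using r MD'(4)[OF r(1) m(1)] by force
        then show ?thesis
          using PM by blast
      qed
      then obtain h where "h \<in> left_ideal_homs ((\<lambda>r. r \<otimes> a) ` carrier R) M" "h a = m"
        using exists_hom_from_cyclic[OF c(1) MD(1) m(1)] by blast
      then show False
        using m(2) a(2) by auto
    qed
    have "a = s \<ominus> m"
      using c by (simp add: s_def a_minus_def a_assoc r_neg)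
    moreover have "s \<ominus> m \<in> ?P"
      using left_idealD(6)[OF P generator_in_principal[OF c(3)]] \<open>M \<subseteq> ?P\<close> m(1) by blast
    ultimately have "a \<in> ?P" by simp
    then have "A \<subseteq> ?P"
      using principal_subset[OF P] a(2) by blast
    then have "A <+> M = ?P"
      using set_add_least[OF P _ \<open>M \<subseteq> ?P\<close>] principal_subset[OF left_ideal_set_add[OF A(1) MD(1)] s] by blast
    then show ?L
      unfolding cyclic_left_ideal_def using s by blast
  }
qed

text \<open>Composition with a torsion-free \<open>\<chi>\<close> embeds \<open>Hom(M, A)\<close>
  into the characters of \<open>M\<close>: two homomorphisms with equal composites differ by one
  whose image lies in the kernel of \<open>\<chi>\<close>. A character that is torsion-free on
  \<open>A\<close> fails on the sum exactly when it is trivial on the graph of a homomorphism from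
  \<open>M\<close> to \<open>A\<close>, that is, when its restriction to \<open>M\<close> is the
  inverse of such a composite.\<close>

lemma torsion_free_character_set_add_iff:
  assumes A: "left_ideal A R" "finite A" and M: "minimal_left_ideal M R" "finite M"
    and AM: "A \<inter> M = {\<zero>}"
  shows "(\<exists>\<chi>. torsion_free_character (A <+> M) \<chi>) \<longleftrightarrow>
    (\<exists>\<chi>. torsion_free_character A \<chi>) \<and> card (left_ideal_homs M A) < card M" (is "?L \<longleftrightarrow> ?R")
proof
  note MD = minimal_left_idealD[OF M(1)]
  note AD' = left_idealD[OF A(1)] and MD' = left_idealD[OF MD(1)]
  note upper = set_add_upper[OF A(1) MD(1)]
  have AM_ideal: "left_ideal (A <+> M) R"
    by (rule left_ideal_set_add[OF A(1) MD(1)])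
  have finH: "finite (left_ideal_homs M A)"
    by (rule finite_left_ideal_homs[OF M(2) A(2)])
  note card_chars = card_left_ideal_characters[OF MD(1) M(2)]
  {
    assume ?L
    then obtain \<chi> where chi: "\<chi> \<in> left_ideal_characters (A <+> M)"
      and tf: "\<And>N. left_ideal N R \<Longrightarrow> N \<subseteq> A <+> M \<Longrightarrow> \<forall>x\<in>N. \<chi> x = 1 \<Longrightarrow> N = {\<zero>}"
      unfolding torsion_free_character_def by blast
    note chiD = left_ideal_charactersD[OF AM_ideal chi]
    have inA: "x \<in> A \<Longrightarrow> x \<in> A <+> M" and inM: "x \<in> M \<Longrightarrow> x \<in> A <+> M" for x :: 'a
      using upper by auto
    have "restrict \<chi> A \<in> left_ideal_characters A"
      using chiD inA AD'(3) by (intro left_ideal_charactersI) auto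
    moreover have "N = {\<zero>}" if "left_ideal N R" "N \<subseteq> A" "\<forall>x\<in>N. restrict \<chi> A x = 1" for N
      using tf[OF that(1)] that(2,3) upper(1) by (metis restrict_apply' subset_iff)
    ultimately have tfA: "torsion_free_character A (restrict \<chi> A)"
      unfolding torsion_free_character_def by blast
    let ?T = "\<lambda>g. \<lambda>x\<in>M. \<chi> (g x)"
    have T: "?T g \<in> left_ideal_characters M" if g: "g \<in> left_ideal_homs M A" for g
      using left_ideal_homsD[OF g] chiD inA MD'(3) by (intro left_ideal_charactersI) auto
    have inj: "inj_on ?T (left_ideal_homs M A)"
    proof (rule inj_onI)
      fix g h assume g: "g \<in> left_ideal_homs M A" and h: "h \<in> left_ideal_homs M A" and eq: "?T g = ?T h"
      let ?d = "\<lambda>x\<in>M. g x \<ominus> h x"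
      have gh: "g x \<in> A" "h x \<in> A" "g x \<in> carrier R" "h x \<in> carrier R" if "x \<in> M" for x
        using that left_ideal_homsD(1)[OF g] left_ideal_homsD(1)[OF h] AD'(1) by auto
      have d: "?d \<in> left_ideal_homs M A"
        using left_ideal_homsD(3,4)[OF g] left_ideal_homsD(3,4)[OF h] gh MD' AD'(6)
        by (intro left_ideal_homsI) (auto simp: a_minus_def minus_add a_ac r_distr r_minus)
      have "\<chi> (?d x) = 1" if "x \<in> M" for x
      proof -
        have "\<chi> (g x) = \<chi> (h x)"
          using that fun_cong[OF eq, of x] by simp
        then show ?thesis
          using that chiD(5)[of "g x" "h x"] chiD(1)[of "h x"] gh inA by simp
      qed
      moreover have "?d ` M \<subseteq> A <+> M"
        using left_ideal_homsD(1)[OF d] inA by blast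
      ultimately have "?d ` M = {\<zero>}"
        using tf[OF left_ideal_homs_image[OF MD(1) A(1) d]] by blast
      then have "g x = h x" if "x \<in> M" for x
        using that gh[OF that] by (metis (no_types, lifting) imageI r_right_minus_eq restrict_apply' singletonD)
      then show "g = h"
        using left_ideal_homs_eqI[OF g h] by blast
    qed
    \<comment> \<open>The inverse is what makes \<open>\<psi>\<close> unreachable:
      \<open>g x \<oplus> x\<close> is in the kernel of \<open>\<chi>\<close> iff
      \<open>\<chi> (g x)\<close> is the inverse of \<open>\<chi> x\<close>. If
      \<open>\<psi>\<close> were a composite, these sums would form a left ideal in the kernel, so
      all of them would be zero and \<open>M\<close> would lie in \<open>A\<close>.\<close>
    define \<psi> where "\<psi> = (\<lambda>x\<in>M. inverse (\<chi> x))"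
    have miss: "?T g \<noteq> \<psi>" if g: "g \<in> left_ideal_homs M A" for g
    proof
      assume "?T g = \<psi>"
      then have eq: "?T g = (\<lambda>x\<in>M. inverse (\<chi> x))"
        by (simp only: \<psi>_def)
      let ?d = "\<lambda>x\<in>M. g x \<oplus> x"
      have gx: "g x \<in> A" "g x \<in> carrier R" if "x \<in> M" for x
        using that left_ideal_homsD(1)[OF g] AD'(1) by auto
      have d: "?d \<in> left_ideal_homs M (A <+> M)"
      proof (rule left_ideal_homsI)
        show "?d x \<in> A <+> M" if "x \<in> M" for x
          using gx(1)[OF that] that unfolding mem_set_add_iff by auto
      qed (use gx left_ideal_homsD(3,4)[OF g] MD' in \<open>auto simp: a_ac r_distr\<close>)
      have "\<chi> (?d x) = 1" if x: "x \<in> M" for x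
        using x fun_cong[OF eq, of x] chiD(3)[OF inA[OF gx(1)[OF x]] inM[OF x]] chiD(1)[OF inM[OF x]]
        by simp
      moreover have "?d ` M \<subseteq> A <+> M"
        using left_ideal_homsD(1)[OF d] by blast
      ultimately have "?d ` M = {\<zero>}"
        using tf[OF left_ideal_homs_image[OF MD(1) AM_ideal d]] by blast
      then have "x \<in> A" if x: "x \<in> M" for x
      proof -
        have "g x \<oplus> x = \<zero>"
          using x \<open>?d ` M = {\<zero>}\<close> by (metis (no_types, lifting) imageI restrict_apply' singletonD)
        then have "x = \<ominus> g x"
          using gx(2)[OF x] MD'(1)[OF x] minus_equality[of x "g x"] by (simp add: a_comm)
        then show ?thesis
          using AD'(5)[OF gx(1)[OF x]] by simp
      qed
      then show False
        using AM MD(2) MD'(2) by blast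
    qed
    have psi: "\<psi> \<in> left_ideal_characters M"
      unfolding \<psi>_def using chiD inM MD'(3) by (intro left_ideal_charactersI) (auto simp: norm_inverse)
    have "?T ` left_ideal_homs M A \<subseteq> left_ideal_characters M"
      using T by (rule image_subsetI)
    moreover have "\<psi> \<notin> ?T ` left_ideal_homs M A"
      using miss by (metis (no_types, lifting) imageE)
    ultimately have "?T ` left_ideal_homs M A \<subset> left_ideal_characters M"
      using psi by (metis psubsetI)
    then have "card (left_ideal_homs M A) < card M"
      using psubset_card_mono[OF card_chars(1)] card_image[OF inj] card_chars(2) by metis
    then show ?R
      using tfA by blast
  next
    assume R: ?R
    then obtain \<chi> where chi: "\<chi> \<in> left_ideal_characters A"
      and tf: "\<And>N. left_ideal N R \<Longrightarrow> N \<subseteq> A \<Longrightarrow> \<forall>x\<in>N. \<chi> x = 1 \<Longrightarrow> N = {\<zero>}"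
      unfolding torsion_free_character_def by blast
    note chiD = left_ideal_charactersD[OF A(1) chi]
    let ?T = "\<lambda>g. \<lambda>x\<in>M. \<chi> (g x)"
    have "card (?T ` left_ideal_homs M A) < card (left_ideal_characters M)"
      using R card_image_le[OF finH, of ?T] card_chars(2) by linarith
    then obtain \<psi> where psi: "\<psi> \<in> left_ideal_characters M" "\<psi> \<notin> ?T ` left_ideal_homs M A"
      using card_mono[OF finite_imageI[OF finH], of "left_ideal_characters M" ?T] by (meson not_less subsetI)
    note psiD = left_ideal_charactersD[OF MD(1) psi(1)]
    obtain p q where p: "p \<in> left_ideal_homs (A <+> M) A" and q: "q \<in> left_ideal_homs (A <+> M) M"
      and pq: "\<And>x. x \<in> A <+> M \<Longrightarrow> p x \<oplus> q x = x"
      and sum: "\<And>a b. a \<in> A \<Longrightarrow> b \<in> M \<Longrightarrow> p (a \<oplus> b) = a \<and> q (a \<oplus> b) = b"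
      by (rule direct_sum_projections[OF A(1) MD(1) AM]) blast
    note pD = left_ideal_homsD[OF p] and qD = left_ideal_homsD[OF q]
    \<comment> \<open>With the quotient, \<open>\<theta> x = 1\<close> reads
      \<open>\<chi> (p x) = \<psi> (q x)\<close>, so that a bad left ideal exhibits
      \<open>\<psi>\<close> itself as a composite.\<close>
    define \<theta> where "\<theta> = (\<lambda>x\<in>A <+> M. \<chi> (p x) / \<psi> (q x))"
    have "\<theta> \<in> left_ideal_characters (A <+> M)"
      using pD(1,3) qD(1,3) chiD psiD left_idealD(3)[OF AM_ideal]
      by (intro left_ideal_charactersI) (auto simp: \<theta>_def norm_divide)
    moreover have "N = {\<zero>}" if N: "left_ideal N R" and NAM: "N \<subseteq> A <+> M" and ker: "\<forall>x\<in>N. \<theta> x = 1" for N :: "'a set"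
    proof (rule ccontr)
      assume nz: "N \<noteq> {\<zero>}"
      \<comment> \<open>On \<open>A\<close> the character \<open>\<theta>\<close> is
        \<open>\<chi>\<close>, so \<open>N\<close> meets \<open>A\<close> in zero only. Hence
        \<open>q\<close> is injective on \<open>N\<close> and, by minimality of \<open>M\<close>,
        maps \<open>N\<close> onto \<open>M\<close>: the left ideal \<open>N\<close> is the graph of
        a homomorphism from \<open>M\<close> to \<open>A\<close>.\<close>
      have NA: "N \<inter> A = {\<zero>}"
      proof (rule tf[OF left_ideal_Int[OF N A(1)]])
        show "\<forall>x\<in>N \<inter> A. \<chi> x = 1"
        proof
          fix x assume x: "x \<in> N \<inter> A"
          then have "p x = x" "q x = \<zero>"
            using sum[of x \<zero>] MD'(2) AD'(1)[of x] by auto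
          then show "\<chi> x = 1"
            using ker x NAM psiD(4) by (force simp: \<theta>_def)
        qed
      qed simp
      have qN: "restrict q N \<in> left_ideal_homs N M"
        by (rule left_ideal_homs_restrict[OF N NAM q]) (use qD(1) NAM in auto)
      have q0: "x = \<zero>" if x: "x \<in> N" "q x = \<zero>" for x
      proof -
        have "x = p x"
          using pq[of x] x NAM pD(1)[of x] AD'(1)[of "p x"] by auto
        then have "x \<in> N \<inter> A"
          using x NAM pD(1)[of x] by auto
        then show ?thesis
          using NA by blast
      qed
      have inj: "inj_on (restrict q N) N"
        by (rule left_ideal_homs_inj_onI[OF N MD(1) qN]) (use q0 in auto)
      have "restrict q N ` N \<noteq> {\<zero>}"
        using q0 nz left_idealD(2)[OF N] by fastforce
      moreover have "restrict q N ` N \<subseteq> M"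
        using left_ideal_homsD(1)[OF qN] by blast
      ultimately have "restrict q N ` N = M"
        using MD(3)[OF left_ideal_homs_image[OF N MD(1) qN]] by blast
      then have bij: "bij_betw (restrict q N) N M"
        using inj by (simp add: bij_betw_def)
      define g where "g = restrict (inv_into N (restrict q N)) M"
      have g: "g \<in> left_ideal_homs M N"
        unfolding g_def by (rule left_ideal_homs_inverse[OF N qN bij])
      have qg: "q (g y) = y" "g y \<in> N" if y: "y \<in> M" for y
      proof -
        show "g y \<in> N"
          using left_ideal_homsD(1)[OF g y] .
        moreover have "restrict q N (g y) = y"
          unfolding g_def restrict_apply'[OF y] by (rule bij_betw_inv_into_right[OF bij y])
        ultimately show "q (g y) = y" by simp
      qed
      have pN: "restrict p N \<in> left_ideal_homs N A"
        by (rule left_ideal_homs_restrict[OF N NAM p]) (use pD(1) NAM in auto)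
      have "compose M (restrict p N) g \<in> left_ideal_homs M A"
        by (rule left_ideal_homs_compose[OF MD(1) g pN])
      moreover have "\<psi> = ?T (compose M (restrict p N) g)"
      proof (rule extensionalityI[of _ M])
        show "\<psi> \<in> extensional M"
          using psi(1) by (simp add: subgroup_characters_iff)
        fix y assume y: "y \<in> M"
        have "\<theta> (g y) = 1" "g y \<in> A <+> M"
          using ker qg(2)[OF y] NAM by auto
        then have "\<chi> (p (g y)) = \<psi> y"
          using psiD(1)[OF y] qg(1)[OF y] by (simp add: \<theta>_def)
        then show "\<psi> y = ?T (compose M (restrict p N) g) y"
          using y qg(2)[OF y] by (simp add: compose_def)
      qed simp
      ultimately show False
        using psi(2) by blast
    qed
    ultimately show ?L
      unfolding torsion_free_character_def by blast
  }
qed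

theorem cyclic_iff_torsion_free_character:
  assumes "finite_semisimple A"
  shows "cyclic_left_ideal A \<longleftrightarrow> (\<exists>\<chi>. torsion_free_character A \<chi>)"
  using assms
proof (induction rule: finite_semisimple.induct)
  case zero
  have "cyclic_left_ideal {\<zero>}"
    unfolding cyclic_left_ideal_def by force
  moreover have "torsion_free_character {\<zero>} (\<lambda>x\<in>{\<zero>}. 1)"
    unfolding torsion_free_character_def
    using left_idealD(2) by (auto intro!: left_ideal_charactersI)
  ultimately show ?case by blast
next
  case (add A M)
  then have "left_ideal A R" "finite A"
    using finite_semisimple_left_ideal by auto
  then show ?case
    using cyclic_set_add_iff torsion_free_character_set_add_iff add
      card_left_ideal_homs_semisimple[OF add.hyps(1)] by metis
qed

end

section \<open>Left Artinian rings\<close>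

lemma (in left_ideal) coset_eq_iff:
  assumes x: "x \<in> carrier R" and y: "y \<in> carrier R"
  shows "I +> x = I +> y \<longleftrightarrow> x \<ominus> y \<in> I"
proof -
  interpret abelian_subgroup I R
    using a_subgroup abelian_group_axioms add.m_comm
    by (intro abelian_subgroupI3 additive_subgroup.intro) auto
  show ?thesis
    using a_rcos_module_minus[OF ring_axioms y x] a_rcos_self[OF x] a_repr_independence[OF _ y a_subgroup] by metis
qed

lemma (in left_ideal) coset_add:
  assumes "x \<in> carrier R" and "y \<in> carrier R"
  shows "(I +> x) <+> (I +> y) = I +> (x \<oplus> y)"
proof -
  interpret abelian_subgroup I R
    using a_subgroup abelian_group_axioms add.m_comm
    by (intro abelian_subgroupI3 additive_subgroup.intro) auto
  show ?thesis
    using a_rcos_sum assms by simp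
qed

section \<open>The radical annihilates semisimple left ideals\<close>

context ring
begin

text \<open>The annihilator of a nonzero \<open>m\<close> is a maximal left ideal, so it contains
  the radical. For maximality, a left ideal \<open>L\<close> above it is tested through its
  multiples of \<open>m\<close>, which form the zero ideal or all of \<open>M\<close>.\<close>

lemma jacobson_radical_annihilates_minimal:
  assumes M: "minimal_left_ideal M R" and j: "j \<in> jacobson_radical R" and m: "m \<in> M"
  shows "j \<otimes> m = \<zero>"
proof (cases "m = \<zero>")
  case True
  then show ?thesis
    using j by (simp add: jacobson_radical_def)
next
  case False
  note MD = minimal_left_idealD[OF M]
  have mc: "m \<in> carrier R"
    using left_idealD(1)[OF MD(1) m] .
  let ?K = "{r \<in> carrier R. r \<otimes> m = \<zero>}"
  have K: "left_ideal ?K R"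
    by (rule left_ideal_annihilator[OF mc])
  have "maximal_left_ideal ?K R"
  proof (intro maximal_left_ideal.intro maximal_left_ideal_axioms.intro K)
    show "?K \<noteq> carrier R"
      using False mc by (metis (mono_tags, lifting) l_one mem_Collect_eq one_closed)
    fix L assume L: "left_ideal L R" "?K \<subseteq> L"
    note LD = left_idealD[OF L(1)]
    have "left_ideal ((\<lambda>r. r \<otimes> m) ` L) R"
    proof (rule left_idealI)
      show "(\<lambda>r. r \<otimes> m) ` L \<subseteq> carrier R"
        using LD(1) mc by auto
      show "\<zero> \<in> (\<lambda>r. r \<otimes> m) ` L"
        using LD(2) mc by (intro image_eqI[of _ _ \<zero>]) auto
      fix x assume "x \<in> (\<lambda>r. r \<otimes> m) ` L"
      then obtain r where r: "r \<in> L" "x = r \<otimes> m" by blast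
      show "s \<otimes> x \<in> (\<lambda>r. r \<otimes> m) ` L" if "s \<in> carrier R" for s
        using that r LD(1,4) mc by (intro image_eqI[of _ _ "s \<otimes> r"]) (auto simp: m_assoc)
      fix y assume "y \<in> (\<lambda>r. r \<otimes> m) ` L"
      then obtain s where s: "s \<in> L" "y = s \<otimes> m" by blast
      show "x \<oplus> y \<in> (\<lambda>r. r \<otimes> m) ` L"
        using r s LD(1,3) mc by (intro image_eqI[of _ _ "r \<oplus> s"]) (auto simp: l_distr)
    qed
    moreover have "(\<lambda>r. r \<otimes> m) ` L \<subseteq> M"
      using left_idealD(4)[OF MD(1) LD(1) m] by blast
    ultimately consider "(\<lambda>r. r \<otimes> m) ` L = {\<zero>}" | "(\<lambda>r. r \<otimes> m) ` L = M"
      using MD(3) by blast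
    then show "L = ?K \<or> L = carrier R"
    proof cases
      case 1
      then show ?thesis
        using L(2) LD(1) by blast
    next
      case 2
      \<comment> \<open>\<open>\<one> \<ominus> i\<close> annihilates \<open>m\<close>, so
        \<open>L\<close> contains it along with \<open>i\<close>, and therefore
        \<open>\<one>\<close>.\<close>
      then obtain i where i: "i \<in> L" "m = i \<otimes> m"
        using m by blast
      have "(\<one> \<ominus> i) \<otimes> m = m \<ominus> i \<otimes> m"
        using LD(1)[OF i(1)] mc by (simp add: a_minus_def l_distr l_minus)
      also have "\<dots> = \<zero>"
        using i(2) mc by simp
      finally have "\<one> \<ominus> i \<in> L"
        using L(2) LD(1)[OF i(1)] by auto
      then have "(\<one> \<ominus> i) \<oplus> i \<in> L"
        using LD(3) i(1) by blast
      then have "\<one> \<in> L"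
        using LD(1)[OF i(1)] by (simp add: a_minus_def a_assoc l_neg)
      then have "r \<in> L" if "r \<in> carrier R" for r
        using LD(4)[OF that, of \<one>] that by simp
      then show ?thesis
        using LD(1) by blast
    qed
  qed
  then show ?thesis
    using j by (auto simp: jacobson_radical_def)
qed

lemma jacobson_radical_annihilates_semisimple:
  assumes "finite_semisimple A" and j: "j \<in> jacobson_radical R" and "a \<in> A"
  shows "j \<otimes> a = \<zero>"
  using assms(1,3)
proof (induction arbitrary: a rule: finite_semisimple.induct)
  case zero
  then show ?case
    using j by (simp add: jacobson_radical_def)
next
  case (add A M)
  obtain b m where b: "b \<in> A" "m \<in> M" "a = b \<oplus> m"
    using add.prems unfolding mem_set_add_iff by blast
  have "b \<in> carrier R" "m \<in> carrier R" "j \<in> carrier R"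
    using left_idealD(1)[OF conjunct1[OF finite_semisimple_left_ideal[OF add.hyps(1)]] b(1)]
      left_idealD(1)[OF minimal_left_idealD(1)[OF add.hyps(2)] b(2)] j
    by (auto simp: jacobson_radical_def)
  then show ?case
    using add.IH[OF b(1)] jacobson_radical_annihilates_minimal[OF add.hyps(2) j b(2)] b(3)
    by (simp add: r_distr)
qed

lemma finite_semisimple_subset_socle:
  assumes "finite_semisimple A"
  shows "A \<subseteq> finitary_left_socle R"
  using assms
proof (induction rule: finite_semisimple.induct)
  case zero
  then show ?case
    using left_idealD(2)[OF left_ideal_finitary_left_socle] by simp
next
  case (add A M)
  have "M \<subseteq> finitary_left_socle R"
    unfolding finitary_left_socle_def using add by (auto intro: generate.incl)
  then show ?case
    using set_add_least[OF left_ideal_finitary_left_socle] add by blast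
qed

end

section \<open>Consequences of the descending chain condition\<close>

context left_artinian_ring
begin

text \<open>The chain condition as a minimum condition: without a minimal element, dependent choice
  would build a strictly decreasing sequence.\<close>

lemma minimal_element:
  assumes P: "\<And>I. P I \<Longrightarrow> left_ideal I R" and I: "P I"
  obtains K where "P K" "\<And>L. P L \<Longrightarrow> L \<subseteq> K \<Longrightarrow> L = K"
proof (rule ccontr)
  assume "\<not> thesis"
  then have step: "\<exists>L. P L \<and> L \<subset> K" if "P K" for K
    using that \<open>\<And>K. P K \<Longrightarrow> (\<And>L. P L \<Longrightarrow> L \<subseteq> K \<Longrightarrow> L = K) \<Longrightarrow> thesis\<close> by blast
  have "\<exists>f. \<forall>n. P (f n) \<and> f (Suc n) \<subset> f n"
    using dependent_nat_choice[of "\<lambda>_. P" "\<lambda>_ K L. L \<subset> K"] I step by metis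
  then obtain f where f: "\<And>n::nat. P (f n)" "\<And>n. f (Suc n) \<subset> f n"
    by blast
  then obtain N where "\<forall>n\<ge>N. f n = f N"
    using descending_chain_condition[of f] P by (metis decseq_SucI less_imp_le)
  then show False
    using f(2)[of N] by (metis le_SucI order_refl psubset_eq)
qed

lemma contains_minimal_left_ideal:
  assumes N: "left_ideal N R" "N \<noteq> {\<zero>}"
  obtains M where "minimal_left_ideal M R" "M \<subseteq> N"
proof -
  obtain M where M: "left_ideal M R \<and> M \<noteq> {\<zero>} \<and> M \<subseteq> N"
    and min: "\<And>L. left_ideal L R \<and> L \<noteq> {\<zero>} \<and> L \<subseteq> N \<Longrightarrow> L \<subseteq> M \<Longrightarrow> L = M"
    using minimal_element[of "\<lambda>M. left_ideal M R \<and> M \<noteq> {\<zero>} \<and> M \<subseteq> N" N] N by blast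
  have "minimal_left_ideal M R"
    by (intro minimal_left_ideal.intro minimal_left_ideal_axioms.intro) (use M min in blast)+
  then show ?thesis
    using M that by blast
qed

text \<open>
  This is the semisimplicity of \<open>R / rad R\<close>.  A left ideal \<open>K\<close> minimal among those above the
  radical with \<open>C + K = R\<close> works: if some maximal left ideal \<open>N\<close> did not contain \<open>C \<inter> K\<close>,
  then \<open>K \<inter> N\<close> would be a smaller one.
\<close>
lemma complement_above_jacobson_radical:
  assumes C: "left_ideal C R" "jacobson_radical R \<subseteq> C"
  obtains K where "left_ideal K R" "C <+> K = carrier R" "C \<inter> K = jacobson_radical R"
proof -
  let ?J = "jacobson_radical R"
  define P where "P K \<longleftrightarrow> left_ideal K R \<and> ?J \<subseteq> K \<and> carrier R \<subseteq> C <+> K" for K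
  note CD = left_idealD[OF C(1)]
  have "P (carrier R)"
    unfolding P_def using left_ideal_carrier set_add_upper(2)[OF C(1) left_ideal_carrier]
    by (auto simp: jacobson_radical_def)
  then obtain K where "P K" and min: "\<And>L. P L \<Longrightarrow> L \<subseteq> K \<Longrightarrow> L = K"
    using minimal_element[of P "carrier R"] by (auto simp: P_def)
  then have K: "left_ideal K R" "?J \<subseteq> K" "carrier R \<subseteq> C <+> K"
    by (auto simp: P_def)
  note KD = left_idealD[OF K(1)]
  have CK: "left_ideal (C \<inter> K) R"
    by (rule left_ideal_Int[OF C(1) K(1)])
  have "C \<inter> K \<subseteq> N" if N: "maximal_left_ideal N R" for N
  proof (rule ccontr)
    assume not_sub: "\<not> C \<inter> K \<subseteq> N"
    have NL: "left_ideal N R" and Nmax: "\<And>L. left_ideal L R \<Longrightarrow> N \<subseteq> L \<Longrightarrow> L = N \<or> L = carrier R"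
      using N by (auto simp: maximal_left_ideal_def maximal_left_ideal_axioms_def)
    note ND = left_idealD[OF NL]
    have "N <+> (C \<inter> K) = carrier R"
      using Nmax[OF left_ideal_set_add[OF NL CK]] set_add_upper[OF NL CK] not_sub by blast
    have "K \<subseteq> C <+> (K \<inter> N)"
    proof
      fix k assume k: "k \<in> K"
      then have "k \<in> N <+> (C \<inter> K)"
        using KD(1) \<open>N <+> (C \<inter> K) = carrier R\<close> by blast
      then obtain n y where ny: "n \<in> N" "y \<in> C \<inter> K" "k = n \<oplus> y"
        unfolding mem_set_add_iff by blast
      have c: "n \<in> carrier R" "y \<in> carrier R"
        using ny ND(1) CD(1) by auto
      have "n = k \<ominus> y"
        using ny(3) c by (simp add: a_minus_def a_assoc r_neg)
      then have "n \<in> K \<inter> N"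
        using KD(6)[OF k, of y] ny by simp
      moreover have "k = y \<oplus> n"
        using ny(3) c by (simp add: a_comm)
      ultimately show "k \<in> C <+> (K \<inter> N)"
        unfolding mem_set_add_iff using ny(2) by blast
    qed
    moreover have CKN: "left_ideal (C <+> (K \<inter> N)) R"
      by (rule left_ideal_set_add[OF C(1) left_ideal_Int[OF K(1) NL]])
    ultimately have "C <+>\<^bsub>R\<^esub> K \<subseteq> C <+> (K \<inter> N)"
      using set_add_least[OF CKN set_add_upper(1)[OF C(1) left_ideal_Int[OF K(1) NL]]] by blast
    moreover have "?J \<subseteq> K \<inter> N"
      using K(2) N by (auto simp: jacobson_radical_def)
    ultimately have "P (K \<inter> N)"
      unfolding P_def using K(3) left_ideal_Int[OF K(1) NL] by blast
    then have "K \<inter> N = K"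
      using min by blast
    then show False
      using not_sub by blast
  qed
  then have "C \<inter> K \<subseteq> ?J"
    using KD(1) by (auto simp: jacobson_radical_def)
  then have "C \<inter> K = ?J"
    using C(2) K(2) by blast
  moreover have "C <+> K = carrier R"
    using K(3) left_idealD(1)[OF left_ideal_set_add[OF C(1) K(1)]] by blast
  ultimately show ?thesis
    using that K(1) by blast
qed

text \<open>Summands are added as long as some finite minimal left ideal lies outside the sum. If
  this never stopped, the summands would form an infinite independent sequence. Its partial sums
  increase, so the chain condition is applied to the sums of its tails instead.\<close>

lemma finite_semisimple_socle: "finite_semisimple (finitary_left_socle R)"
proof -
  have "\<exists>A. finite_semisimple A \<and> (\<forall>M. minimal_left_ideal M R \<and> finite M \<longrightarrow> M \<subseteq> A)"
  proof (rule ccontr)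
    assume contra: "\<not> ?thesis"
    define next_ideal where "next_ideal A = (SOME M. minimal_left_ideal M R \<and> finite M \<and> \<not> M \<subseteq> A)" for A
    have nxt: "minimal_left_ideal (next_ideal A) R" "finite (next_ideal A)" "A \<inter> next_ideal A = {\<zero>}"
      if A: "finite_semisimple A" for A
    proof -
      have "\<exists>M. minimal_left_ideal M R \<and> finite M \<and> \<not> M \<subseteq> A"
        using contra A by blast
      then have *: "minimal_left_ideal (next_ideal A) R \<and> finite (next_ideal A) \<and> \<not> next_ideal A \<subseteq> A"
        unfolding next_ideal_def by (rule someI_ex)
      then show "minimal_left_ideal (next_ideal A) R" "finite (next_ideal A)"
        by blast+
      have "A \<inter> next_ideal A = {\<zero>} \<or> A \<inter> next_ideal A = next_ideal A"
        using minimal_left_idealD(1,3)[of "next_ideal A"] * left_ideal_Int finite_semisimple_left_ideal[OF A]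
        by (metis Int_lower2)
      then show "A \<inter> next_ideal A = {\<zero>}"
        using * by blast
    qed
    \<comment> \<open>\<open>F n\<close> is the sum of the first \<open>n\<close> summands and
      \<open>G n k\<close> that of the \<open>k\<close> summands from \<open>M n\<close> on; the
      union of the \<open>G n k\<close> over \<open>k\<close> is the tail starting at
      \<open>M n\<close>.\<close>
    define F where "F = rec_nat {\<zero>} (\<lambda>_ A. A <+> next_ideal A)"
    define M where "M n = next_ideal (F n)" for n
    define G where "G n = rec_nat {\<zero>} (\<lambda>k A. A <+> M (n + k))" for n
    have F0: "F 0 = {\<zero>}" and FSuc: "F (Suc n) = F n <+> M n" for n
      by (simp_all add: F_def M_def)
    have G0: "G n 0 = {\<zero>}" and GSuc: "G n (Suc k) = G n k <+> M (n + k)" for n k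
      by (simp_all add: G_def)
    have ssF: "finite_semisimple (F n)" for n
      by (induction n) (simp_all add: F0 FSuc M_def finite_semisimple.zero finite_semisimple.add nxt)
    then have F: "left_ideal (F n) R" and M: "left_ideal (M n) R" "M n \<noteq> {\<zero>}" and FM: "F n \<inter> M n = {\<zero>}" for n
      using finite_semisimple_left_ideal nxt minimal_left_idealD by (auto simp: M_def)
    have G: "left_ideal (G n k) R" for n k
      by (induction k) (simp_all add: G0 GSuc left_ideal_zero left_ideal_set_add M)
    \<comment> \<open>The inclusion is carried along with the independence because the induction
      step needs it: if \<open>x = g \<oplus> m\<close> lies in \<open>F n\<close>, then
      \<open>m = x \<oplus> (\<ominus> g)\<close> falls into \<open>F (n + k)\<close>, which meets
      \<open>M (n + k)\<close> in zero only.\<close>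
    have FG: "F n <+> G n k \<subseteq> F (n + k) \<and> F n \<inter> G n k = {\<zero>}" for n k
    proof (induction k)
      case 0
      show ?case
        using left_idealD(2)[OF F[of n]] set_add_least[OF F[of n], of "F n" "{\<zero>}"] by (simp add: G0)
    next
      case (Suc k)
      note FD = left_idealD[OF F[of n]] and GD = left_idealD[OF G[of n k]] and MD = left_idealD[OF M(1)[of "n + k"]]
      have "F n <+> G n (Suc k) \<subseteq> F (n + Suc k)"
      proof
        fix x :: 'a assume "x \<in> F n <+> G n (Suc k)"
        then obtain f h where "f \<in> F n" "h \<in> G n k <+>\<^bsub>R\<^esub> M (n + k)" "x = f \<oplus> h"
          unfolding GSuc mem_set_add_iff[of x] by blast
        then obtain g m where x: "f \<in> F n" "g \<in> G n k" "m \<in> M (n + k)" "x = f \<oplus> (g \<oplus> m)"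
          unfolding mem_set_add_iff by blast
        then have "x = (f \<oplus> g) \<oplus> m"
          using FD(1) GD(1) MD(1) by (simp add: a_assoc)
        moreover have "f \<oplus> g \<in> F (n + k)"
          using x Suc.IH mem_set_add_iff by blast
        ultimately show "x \<in> F (n + Suc k)"
          using x(3) by (auto simp: FSuc mem_set_add_iff)
      qed
      moreover have "x = \<zero>" if x: "x \<in> F n" "x \<in> G n (Suc k)" for x
      proof -
        obtain g m where gm: "g \<in> G n k" "m \<in> M (n + k)" "x = g \<oplus> m"
          using x(2) unfolding GSuc mem_set_add_iff by blast
        have c: "x \<in> carrier R" "g \<in> carrier R" "m \<in> carrier R"
          using x gm FD(1) GD(1) MD(1) by auto
        have "m = x \<oplus> (\<ominus> g)"
          using gm(3) c by (simp add: a_comm[of g m] a_assoc r_neg)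
        moreover have "x \<oplus> (\<ominus> g) \<in> F n <+> G n k"
          unfolding mem_set_add_iff using x(1) GD(5)[OF gm(1)] by blast
        ultimately have "m \<in> F (n + k) \<inter> M (n + k)"
          using Suc.IH gm(2) by blast
        then have "m = \<zero>"
          using FM by blast
        then have "x \<in> F n \<inter> G n k"
          using gm c x(1) by simp
        then show ?thesis
          using Suc.IH by blast
      qed
      ultimately show ?case
        using FD(2) left_idealD(2)[OF G] by blast
    qed
    define L where "L n = (\<Union>k. G n k)" for n
    have G_mono: "G n k \<subseteq> G n l" if "k \<le> l" for n k l
      using that by (rule lift_Suc_mono_le[of "G n", rotated])
        (use set_add_upper(1)[OF G M(1)] in \<open>simp add: GSuc\<close>)
    have L: "left_ideal (L n) R" for n
    proof (rule left_idealI)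
      show "L n \<subseteq> carrier R"
        using left_idealD(1)[OF G] by (auto simp: L_def)
      show "\<zero> \<in> L n"
        using left_idealD(2)[OF G] by (auto simp: L_def)
      show "r \<otimes> a \<in> L n" if "r \<in> carrier R" "a \<in> L n" for r a
        using that left_idealD(4)[OF G] unfolding L_def by blast
      fix a b assume "a \<in> L n" "b \<in> L n"
      then obtain k l where "a \<in> G n k" "b \<in> G n l"
        unfolding L_def by blast
      then have "a \<in> G n (max k l)" "b \<in> G n (max k l)"
        using G_mono max.cobounded1 max.cobounded2 by blast+
      then show "a \<oplus> b \<in> L n"
        using left_idealD(3)[OF G] unfolding L_def by blast
    qed
    have "G (Suc n) k \<subseteq> G n (Suc k)" for n k
    proof (induction k)
      case 0
      show ?case
        using left_idealD(2)[OF G] by (simp add: G0)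
    next
      case (Suc k)
      have "M (n + Suc k) \<subseteq> G n (Suc (Suc k))" "G n (Suc k) \<subseteq> G n (Suc (Suc k))"
        unfolding GSuc[of n "Suc k"] using set_add_upper[OF G[of n "Suc k"] M(1)[of "n + Suc k"]] by simp_all
      then show ?case
        unfolding GSuc[of "Suc n" k] using Suc.IH
        by (intro set_add_least[OF G]) (simp_all add: order_trans[of _ "G n (Suc k)"])
    qed
    then have "decseq L"
      by (intro decseq_SucI) (auto simp: L_def)
    then obtain N where N: "\<And>n. n \<ge> N \<Longrightarrow> L n = L N"
      using descending_chain_condition[of L] L by blast
    \<comment> \<open>Where the tails become constant, \<open>M N\<close> lies in the tail that
      starts after it and also in \<open>F (Suc N)\<close>, although the two are
      independent.\<close>
    have LN: "L (Suc N) = L N"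
      by (rule N) simp
    have "M N \<subseteq> G N (Suc 0)"
      unfolding GSuc using set_add_upper(2)[OF G M(1)] by simp
    then have "M N \<subseteq> L (Suc N)"
      unfolding LN by (auto simp: L_def)
    moreover have "M N \<subseteq> F (Suc N)"
      unfolding FSuc using set_add_upper(2)[OF F M(1)] .
    ultimately have "M N \<subseteq> {\<zero>}"
      using FG[of "Suc N"] unfolding L_def by blast
    then show False
      using M(2) left_idealD(2)[OF M(1)] by blast
  qed
  then obtain A where A: "finite_semisimple A" and max: "\<And>M. minimal_left_ideal M R \<Longrightarrow> finite M \<Longrightarrow> M \<subseteq> A"
    by blast
  have "subgroup A (add_monoid R)"
    using finite_semisimple_left_ideal[OF A] left_ideal.axioms(1) additive_subgroup.a_subgroup by blast
  then have "finitary_left_socle R \<subseteq> A"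
    unfolding finitary_left_socle_def using max by (intro add.generate_subgroup_incl) auto
  then have "finitary_left_socle R = A"
    using finite_semisimple_subset_socle[OF A] by blast
  then show ?thesis
    using A by simp
qed

section \<open>Embeddings into the ring modulo its radical\<close>

lemma left_module_embeds_quotient_iff:
  "left_module_embeds R (left_ideal_module R S) (left_quotient_module R (jacobson_radical R)) \<longleftrightarrow>
    (\<exists>f. (\<forall>x\<in>S. f x \<in> a_rcosets (jacobson_radical R)) \<and>
      (\<forall>x\<in>S. \<forall>y\<in>S. f (x \<oplus> y) = f x <+> f y) \<and>
      (\<forall>r\<in>carrier R. \<forall>x\<in>S. f (r \<otimes> x) = r \<odot>\<^bsub>left_quotient_module R (jacobson_radical R)\<^esub> f x) \<and>
      inj_on f S)"
  unfolding left_module_embeds_def left_module_hom_def hom_def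
  by (auto simp: left_ideal_module_def left_quotient_module_def Pi_iff)

text \<open>Both directions split \<open>\<one>\<close> along a complement. The image of an
  embedding is a direct summand of \<open>R / rad R\<close>, hence generated by the component of
  \<open>\<one>\<close> in it. Conversely, a cyclic \<open>S\<close> is \<open>R\<close> modulo the
  annihilator of its generator; this annihilator contains the radical, so its complement, taken
  modulo the radical, is a copy of \<open>S\<close>.\<close>

theorem embeds_iff_cyclic:
  assumes S: "finite_semisimple S"
  shows "left_module_embeds R (left_ideal_module R S) (left_quotient_module R (jacobson_radical R)) \<longleftrightarrow>
    cyclic_left_ideal S"
proof
  let ?J = "jacobson_radical R"
  interpret J: left_ideal ?J R
    by (rule left_ideal_jacobson_radical)
  note JD = left_idealD[OF left_ideal_jacobson_radical]
  note SD = left_idealD[OF conjunct1[OF finite_semisimple_left_ideal[OF S]]]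
  have ex_rep: "\<exists>y\<in>carrier R. c = ?J +> y" if "c \<in> a_rcosets ?J" for c
    using that by (auto simp: A_RCOSETS_def RCOSETS_def a_r_coset_def)
  have coset_mem: "?J +> y \<in> a_rcosets ?J" if "y \<in> carrier R" for y
    using that by (auto simp: A_RCOSETS_def RCOSETS_def a_r_coset_def)
  {
    assume "left_module_embeds R (left_ideal_module R S) (left_quotient_module R ?J)"
    then obtain f where f: "\<And>x. x \<in> S \<Longrightarrow> f x \<in> a_rcosets ?J"
      and add: "\<And>x y. x \<in> S \<Longrightarrow> y \<in> S \<Longrightarrow> f (x \<oplus> y) = f x <+> f y"
      and smult: "\<And>r x. r \<in> carrier R \<Longrightarrow> x \<in> S \<Longrightarrow> f (r \<otimes> x) = r \<odot>\<^bsub>left_quotient_module R ?J\<^esub> f x"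
      and inj: "inj_on f S"
      unfolding left_module_embeds_quotient_iff by blast
    \<comment> \<open>The full preimage in \<open>R\<close> of the image of \<open>f\<close>: a left
      ideal above the radical, so that it has a complement.\<close>
    let ?C = "{y \<in> carrier R. ?J +> y \<in> f ` S}"
    have f_smult: "f (r \<otimes> x) = ?J +> (r \<otimes> y)" if "r \<in> carrier R" "x \<in> S" "y \<in> carrier R" "f x = ?J +> y" for r x y
      using that smult J.left_quotient_smult by simp
    have f_add: "f (x \<oplus> x') = ?J +> (y \<oplus> y')"
      if "x \<in> S" "y \<in> carrier R" "f x = ?J +> y" "x' \<in> S" "y' \<in> carrier R" "f x' = ?J +> y'" for x x' y y'
      using that add J.coset_add by simp
    have f_zero: "f \<zero> = ?J +> \<zero>"
    proof -
      obtain y where "y \<in> carrier R" "f \<zero> = ?J +> y"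
        using ex_rep f SD(2) by blast
      then show ?thesis
        using f_smult[of \<zero> \<zero> y] SD(2) by simp
    qed
    have C: "left_ideal ?C R"
    proof (rule left_idealI)
      show "\<zero> \<in> ?C"
        using f_zero SD(2) by (auto intro: image_eqI[of _ _ \<zero>])
      fix y assume "y \<in> ?C"
      then obtain x where x: "y \<in> carrier R" "x \<in> S" "f x = ?J +> y"
        by force
      show "r \<otimes> y \<in> ?C" if "r \<in> carrier R" for r
        using f_smult[OF that x(2,1,3)] x that SD(4) by (auto intro: image_eqI[of _ _ "r \<otimes> x"])
      fix y' assume "y' \<in> ?C"
      then obtain x' where x': "y' \<in> carrier R" "x' \<in> S" "f x' = ?J +> y'"
        by force
      show "y \<oplus> y' \<in> ?C"
        using f_add[OF x(2,1,3) x'(2,1,3)] x x' SD(3) by (auto intro: image_eqI[of _ _ "x \<oplus> x'"])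
    qed auto
    have "?J \<subseteq> ?C"
    proof
      fix j assume j: "j \<in> ?J"
      then have "?J +> j = f \<zero>"
        using f_zero JD(1)[OF j] JD(6)[OF j JD(2)] J.coset_eq_iff[of j \<zero>] by simp
      then show "j \<in> ?C"
        using JD(1)[OF j] SD(2) by auto
    qed
    then obtain K where K: "left_ideal K R" "?C <+> K = carrier R" "?C \<inter> K = ?J"
      using complement_above_jacobson_radical[OF C] by blast
    note CD = left_idealD[OF C] and KD = left_idealD[OF K(1)]
    have "\<one> \<in> ?C <+> K"
      using K(2) by simp
    then obtain c k where ck: "c \<in> ?C" "k \<in> K" "\<one> = c \<oplus> k"
      unfolding mem_set_add_iff by blast
    have cc: "c \<in> carrier R" "k \<in> carrier R"
      using CD(1)[OF ck(1)] KD(1)[OF ck(2)] .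
    obtain s where s: "s \<in> S" "f s = ?J +> c"
      using ck(1) by force
    have "S \<subseteq> (\<lambda>r. r \<otimes> s) ` carrier R"
    proof
      fix x assume x: "x \<in> S"
      obtain y where y: "y \<in> carrier R" "f x = ?J +> y"
        using ex_rep f x by blast
      then have yC: "y \<in> ?C"
        using x by force
      \<comment> \<open>\<open>y \<otimes> k\<close> lies in \<open>K\<close> and, being
        \<open>y \<ominus> y \<otimes> c\<close>, also in \<open>?C\<close>, hence in the radical.
        Modulo the radical, \<open>c\<close> is thus a right identity on \<open>?C\<close>.\<close>
      have "y = y \<otimes> (c \<oplus> k)"
        using ck(3)[symmetric] y(1) by simp
      then have "y \<ominus> y \<otimes> c = y \<otimes> k"
        using y(1) cc r_distr[OF cc y(1)] minus_eq[of y "y \<otimes> c"]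
        by (metis a_comm add.inv_solve_right' m_closed)
      moreover have "y \<ominus> y \<otimes> c \<in> ?C"
        by (rule CD(6)[OF yC CD(4)[OF y(1) ck(1)]])
      moreover have "y \<otimes> k \<in> K"
        by (rule KD(4)[OF y(1) ck(2)])
      ultimately have "y \<ominus> y \<otimes> c \<in> ?J"
        using K(3) by auto
      then have "f x = ?J +> (y \<otimes> c)"
        using y cc J.coset_eq_iff by simp
      also have "\<dots> = f (y \<otimes> s)"
        using f_smult[OF y(1) s(1) cc(1) s(2)] by simp
      finally have "x = y \<otimes> s"
        using inj x SD(4)[OF y(1) s(1)] by (simp add: inj_on_eq_iff)
      then show "x \<in> (\<lambda>r. r \<otimes> s) ` carrier R"
        using y(1) by blast
    qed
    then show "cyclic_left_ideal S"
      unfolding cyclic_left_ideal_def using s(1) SD(4) by blast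
  next
    assume "cyclic_left_ideal S"
    then obtain s where s: "s \<in> S" "S = (\<lambda>r. r \<otimes> s) ` carrier R"
      unfolding cyclic_left_ideal_def by blast
    have sc: "s \<in> carrier R"
      using SD(1)[OF s(1)] .
    let ?K = "{r \<in> carrier R. r \<otimes> s = \<zero>}"
    have K: "left_ideal ?K R"
      by (rule left_ideal_annihilator[OF sc])
    have "?J \<subseteq> ?K"
      using jacobson_radical_annihilates_semisimple[OF S _ s(1)] JD(1) by blast
    then obtain C where C: "left_ideal C R" "?K <+> C = carrier R" "?K \<inter> C = ?J"
      using complement_above_jacobson_radical[OF K] by blast
    note KD = left_idealD[OF K] and CD = left_idealD[OF C(1)]
    have "\<one> \<in> ?K <+> C"
      using C(2) by simp
    then obtain k c where kc: "k \<in> ?K" "c \<in> C" "\<one> = k \<oplus> c"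
      unfolding mem_set_add_iff by blast
    have cc: "c \<in> carrier R" "k \<in> carrier R"
      using CD(1)[OF kc(2)] KD(1)[OF kc(1)] .
    have decomp: "t = t \<otimes> k \<oplus> t \<otimes> c" if "t \<in> carrier R" for t
      using that kc(3)[symmetric] cc r_distr[of k c t] by simp
    \<comment> \<open>Right multiplication by \<open>c\<close> identifies \<open>R\<close> modulo
      the annihilator of \<open>s\<close> with \<open>C\<close> modulo the radical. The two
      implications make the map from \<open>r \<otimes> s\<close> to the coset of
      \<open>r \<otimes> c\<close> injective and well defined.\<close>
    have ann: "t \<otimes> s = \<zero> \<longleftrightarrow> t \<otimes> c \<in> ?J" if t: "t \<in> carrier R" for t
    proof
      assume "t \<otimes> s = \<zero>"
      then have tK: "t \<in> ?K"
        using t by simp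
      have "t \<otimes> c = t \<ominus> t \<otimes> k"
        using decomp[OF t] t cc by (metis a_comm add.inv_solve_right' m_closed minus_eq)
      then have "t \<otimes> c \<in> ?K"
        using KD(6)[OF tK KD(4)[OF t kc(1)]] by metis
      then show "t \<otimes> c \<in> ?J"
        using C(3) CD(4)[OF t kc(2)] by blast
    next
      assume "t \<otimes> c \<in> ?J"
      then have "t \<otimes> c \<in> ?K"
        using \<open>?J \<subseteq> ?K\<close> by blast
      then have "t \<otimes> k \<oplus> t \<otimes> c \<in> ?K"
        by (rule KD(3)[OF KD(4)[OF t kc(1)]])
      then have "t \<in> ?K"
        using decomp[OF t] by metis
      then show "t \<otimes> s = \<zero>"
        by simp
    qed
    have eq_iff: "?J +> (r \<otimes> c) = ?J +> (r' \<otimes> c) \<longleftrightarrow> r \<otimes> s = r' \<otimes> s" if r: "r \<in> carrier R" "r' \<in> carrier R" for r r'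
    proof -
      have "(r \<ominus> r') \<otimes> c = r \<otimes> c \<ominus> r' \<otimes> c" "(r \<ominus> r') \<otimes> s = r \<otimes> s \<ominus> r' \<otimes> s"
        using r cc sc by (simp_all add: a_minus_def l_distr l_minus)
      then show ?thesis
        using ann[of "r \<ominus> r'"] r cc sc J.coset_eq_iff by simp
    qed
    define f where "f x = ?J +> ((SOME r. r \<in> carrier R \<and> x = r \<otimes> s) \<otimes> c)" for x
    have f: "f (r \<otimes> s) = ?J +> (r \<otimes> c)" if r: "r \<in> carrier R" for r
    proof -
      define q where "q = (SOME q. q \<in> carrier R \<and> r \<otimes> s = q \<otimes> s)"
      have "q \<in> carrier R \<and> r \<otimes> s = q \<otimes> s"
        unfolding q_def by (rule someI[of _ r]) (use r in simp)
      then have "?J +> (q \<otimes> c) = ?J +> (r \<otimes> c)"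
        using eq_iff[of q r] r by simp
      then show ?thesis
        by (simp add: f_def q_def)
    qed
    have "\<forall>x\<in>S. f x \<in> a_rcosets ?J"
      using s(2) f coset_mem cc by auto
    moreover have "\<forall>x\<in>S. \<forall>y\<in>S. f (x \<oplus> y) = f x <+> f y"
    proof (intro ballI)
      fix x y assume "x \<in> S" "y \<in> S"
      then obtain r q where r: "r \<in> carrier R" "x = r \<otimes> s" and q: "q \<in> carrier R" "y = q \<otimes> s"
        using s(2) by blast
      show "f (x \<oplus> y) = f x <+> f y"
        using f[of "r \<oplus> q"] f[of r] f[of q] r q sc cc by (simp add: l_distr J.coset_add)
    qed
    moreover have "\<forall>r\<in>carrier R. \<forall>x\<in>S. f (r \<otimes> x) = r \<odot>\<^bsub>left_quotient_module R ?J\<^esub> f x"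
    proof (intro ballI)
      fix r x assume r: "r \<in> carrier R" and "x \<in> S"
      then obtain q where q: "q \<in> carrier R" "x = q \<otimes> s"
        using s(2) by blast
      show "f (r \<otimes> x) = r \<odot>\<^bsub>left_quotient_module R ?J\<^esub> f x"
        using f[of "r \<otimes> q"] f[of q] r q sc cc by (simp add: m_assoc J.left_quotient_smult)
    qed
    moreover have "inj_on f S"
    proof (rule inj_onI)
      fix x y assume "x \<in> S" "y \<in> S" and eq: "f x = f y"
      then obtain r q where r: "r \<in> carrier R" "x = r \<otimes> s" and q: "q \<in> carrier R" "y = q \<otimes> s"
        using s(2) by blast
      then show "x = y"
        using eq f eq_iff by simp
    qed
    ultimately show "left_module_embeds R (left_ideal_module R S) (left_quotient_module R ?J)"
      unfolding left_module_embeds_quotient_iff by blast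
  }
qed

end

section \<open>The groups \<open>\<rat>/\<int>\<close> and \<open>\<T>\<close>\<close>

definition rat_class :: "rat \<Rightarrow> rat set"
  where "rat_class q = {p. p - q \<in> \<int>}"

definition rat_circle :: "rat \<Rightarrow> complex"
  where "rat_circle q = cis (2 * pi * of_rat q)"

lemma rat_class_eq_iff: "rat_class p = rat_class q \<longleftrightarrow> p - q \<in> \<int>"
proof
  assume "rat_class p = rat_class q"
  then have "p \<in> rat_class q"
    by (auto simp: rat_class_def)
  then show "p - q \<in> \<int>"
    by (simp add: rat_class_def)
next
  assume pq: "p - q \<in> \<int>"
  have "r - p \<in> \<int> \<longleftrightarrow> r - q \<in> \<int>" for r
    using pq Ints_add[of "r - p" "p - q"] Ints_diff[of "r - q" "p - q"] by auto
  then show "rat_class p = rat_class q"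
    by (simp add: rat_class_def)
qed

lemma rat_circle_add: "rat_circle (p + q) = rat_circle p * rat_circle q"
  by (simp add: rat_circle_def of_rat_add cis_mult algebra_simps)

lemma norm_rat_circle: "cmod (rat_circle q) = 1"
  by (simp add: rat_circle_def)

lemma rat_circle_eq_1_iff: "rat_circle q = 1 \<longleftrightarrow> q \<in> \<int>"
proof
  assume "rat_circle q = 1"
  then have "cos (2 * pi * of_rat q) = 1"
    by (simp add: rat_circle_def complex_eq_iff)
  then obtain n :: int where "2 * pi * of_rat q = real_of_int n * 2 * pi"
    using cos_one_2pi_int by auto
  then have "real_of_rat q = real_of_rat (of_int n)"
    by simp
  then show "q \<in> \<int>"
    by (simp only: of_rat_eq_iff Ints_of_int)
next
  assume "q \<in> \<int>"
  then show "rat_circle q = 1"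
    by (auto simp: rat_circle_def elim: Ints_cases)
qed

text \<open>The exponential \<open>rat_circle\<close> has kernel \<open>\<int>\<close>, so
  equalities in \<open>\<rat>/\<int>\<close> can be checked in the circle and conversely.\<close>

lemma rat_circle_eq_iff: "rat_circle p = rat_circle q \<longleftrightarrow> rat_class p = rat_class q"
proof -
  have "rat_circle p = rat_circle (p - q) * rat_circle q"
    by (simp flip: rat_circle_add)
  moreover have "rat_circle q \<noteq> 0"
    using norm_rat_circle[of q] by force
  ultimately have "rat_circle p = rat_circle q \<longleftrightarrow> rat_circle (p - q) = 1"
    by simp
  then show ?thesis
    by (simp add: rat_circle_eq_1_iff rat_class_eq_iff)
qed

lemma carrier_rat_mod_int: "carrier rat_mod_int = range rat_class"
proof -
  have "(\<Union>h\<in>\<int>. {h + q}) = rat_class q" for q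
  proof (intro equalityI subsetI)
    fix p assume "p \<in> rat_class q"
    then have "p - q \<in> \<int>" "p = (p - q) + q"
      by (simp_all add: rat_class_def)
    then show "p \<in> (\<Union>h\<in>\<int>. {h + q})"
      by blast
  qed (auto simp: rat_class_def)
  then show ?thesis
    by (auto simp: rat_mod_int_def FactGroup_def RCOSETS_def r_coset_def)
qed

lemma rat_mod_int_mult: "rat_class p \<otimes>\<^bsub>rat_mod_int\<^esub> rat_class q = rat_class (p + q)"
proof -
  have "(\<Union>h\<in>rat_class p. \<Union>k\<in>rat_class q. {h + k}) = rat_class (p + q)"
  proof (intro equalityI subsetI)
    fix r assume "r \<in> (\<Union>h\<in>rat_class p. \<Union>k\<in>rat_class q. {h + k})"
    then obtain h k where "h - p \<in> \<int>" "k - q \<in> \<int>" "r = h + k"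
      by (auto simp: rat_class_def)
    then show "r \<in> rat_class (p + q)"
      using Ints_add[of "h - p" "k - q"] by (simp add: rat_class_def algebra_simps)
  next
    fix r assume "r \<in> rat_class (p + q)"
    then have "r - q \<in> rat_class p" "q \<in> rat_class q" "r = (r - q) + q"
      by (simp_all add: rat_class_def algebra_simps)
    then show "r \<in> (\<Union>h\<in>rat_class p. \<Union>k\<in>rat_class q. {h + k})"
      by blast
  qed
  then show ?thesis
    by (simp add: rat_mod_int_def FactGroup_def set_mult_def)
qed

lemma rat_mod_int_one: "\<one>\<^bsub>rat_mod_int\<^esub> = rat_class 0"
  by (auto simp: rat_mod_int_def FactGroup_def rat_class_def)

lemma rat_mod_int_divisible:
  assumes "c \<in> carrier rat_mod_int" "n > 0"
  shows "\<exists>z\<in>carrier rat_mod_int. z [^]\<^bsub>rat_mod_int\<^esub> (n::nat) = c"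
proof -
  obtain q where q: "c = rat_class q"
    using assms(1) by (auto simp: carrier_rat_mod_int)
  interpret comm_group rat_mod_int
    by (rule comm_group_rat_mod_int)
  have "rat_class (q / of_nat n) [^]\<^bsub>rat_mod_int\<^esub> m = rat_class (of_nat m * (q / of_nat n))" for m :: nat
    by (induction m) (simp_all add: rat_mod_int_one rat_mod_int_mult algebra_simps add_divide_distrib)
  then have "rat_class (q / of_nat n) [^]\<^bsub>rat_mod_int\<^esub> n = c"
    using assms(2) q by simp
  then show ?thesis
    by (auto simp: carrier_rat_mod_int)
qed

text \<open>The kernel of \<open>\<iota>\<close> is trivial, so composition with it turns a
  homomorphism into \<open>\<rat>/\<int>\<close> into a character with the same kernel.\<close>

lemma rat_mod_int_embeds_circle_group:
  obtains \<iota> where "\<iota> \<in> hom rat_mod_int circle_group"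
    "\<And>c. c \<in> carrier rat_mod_int \<Longrightarrow> \<iota> c = 1 \<longleftrightarrow> c = \<one>\<^bsub>rat_mod_int\<^esub>"
proof -
  define \<iota> where "\<iota> c = rat_circle (SOME q. c = rat_class q)" for c
  have iota: "\<iota> (rat_class q) = rat_circle q" for q
    unfolding \<iota>_def rat_circle_eq_iff by (rule sym, rule someI_ex) blast
  have "\<iota> \<in> hom rat_mod_int circle_group"
    by (rule homI) (auto simp: carrier_rat_mod_int iota norm_rat_circle rat_mod_int_mult
        rat_circle_add circle_group_def)
  moreover have "\<iota> c = 1 \<longleftrightarrow> c = \<one>\<^bsub>rat_mod_int\<^esub>" if c: "c \<in> carrier rat_mod_int" for c
  proof -
    obtain q where "c = rat_class q"
      using c by (auto simp: carrier_rat_mod_int)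
    then show ?thesis
      by (simp add: iota rat_circle_eq_1_iff rat_mod_int_one rat_class_eq_iff)
  qed
  ultimately show ?thesis
    using that by blast
qed

text \<open>On a group of order \<open>n\<close> a character takes values among the
  \<open>n\<close>-th roots of unity, which are the images under \<open>rat_circle\<close> of the
  fractions \<open>k / n\<close>.\<close>

lemma (in ring) character_lifts_to_rat_mod_int:
  assumes S: "left_ideal S R" "finite S" and chi: "\<chi> \<in> left_ideal_characters S"
  obtains \<phi> where "\<phi> \<in> hom (add_monoid R\<lparr>carrier := S\<rparr>) rat_mod_int"
    "\<And>x. x \<in> S \<Longrightarrow> \<phi> x = \<one>\<^bsub>rat_mod_int\<^esub> \<longleftrightarrow> \<chi> x = 1"
proof -
  have "subgroup S (add_monoid R)"
    using S left_ideal.axioms(1) additive_subgroup.a_subgroup by blast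
  then interpret S: group "add_monoid R\<lparr>carrier := S\<rparr>"
    by (rule add.subgroup_imp_group)
  interpret C: comm_group circle_group
    by (rule comm_group_circle_group)
  interpret chi: group_hom "add_monoid R\<lparr>carrier := S\<rparr>" circle_group \<chi>
    by (intro group_hom.intro group_hom_axioms.intro S.group_axioms C.group_axioms)
      (use chi in \<open>simp add: subgroup_characters_def\<close>)
  have "\<exists>q. \<chi> x = rat_circle q" if x: "x \<in> S" for x
  proof -
    define n where "n = order (add_monoid R\<lparr>carrier := S\<rparr>)"
    have n: "n > 0"
      using S(2) S.order_gt_0_iff_finite by (simp add: n_def)
    have "\<chi> x ^ n = 1"
      using chi.hom_nat_pow[of x n] S.pow_order_eq_1[of x] chi.hom_one x
      by (simp add: n_def circle_group_nat_pow) (simp add: circle_group_def)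
    then have "\<chi> x \<in> (\<lambda>k. cis (2 * pi * real k / real n)) ` {..<n}"
      using bij_betw_imp_surj_on[OF bij_betw_roots_unity[OF n]] by simp
    then obtain k where "\<chi> x = cis (2 * pi * real k / real n)"
      by blast
    then have "\<chi> x = rat_circle (of_nat k / of_nat n)"
      by (simp add: rat_circle_def of_rat_divide)
    then show ?thesis by blast
  qed
  then obtain q where q: "\<And>x. x \<in> S \<Longrightarrow> \<chi> x = rat_circle (q x)"
    by metis
  note chiD = left_ideal_charactersD[OF S(1) chi]
  \<comment> \<open>The numbers \<open>q x\<close> are chosen independently and need not be additive
    in \<open>x\<close>. Their classes are, because \<open>rat_circle\<close> determines the
    class.\<close>
  have "(\<lambda>x. rat_class (q x)) \<in> hom (add_monoid R\<lparr>carrier := S\<rparr>) rat_mod_int"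
  proof (rule homI)
    show "rat_class (q x) \<in> carrier rat_mod_int" for x
      by (simp add: carrier_rat_mod_int)
    fix x y assume "x \<in> carrier (add_monoid R\<lparr>carrier := S\<rparr>)" "y \<in> carrier (add_monoid R\<lparr>carrier := S\<rparr>)"
    then have xy: "x \<in> S" "y \<in> S" "x \<oplus> y \<in> S"
      using left_idealD(3)[OF S(1)] by auto
    have "rat_circle (q (x \<oplus> y)) = rat_circle (q x + q y)"
      using chiD(3)[OF xy(1,2)] q xy by (simp add: rat_circle_add)
    then show "rat_class (q (x \<otimes>\<^bsub>add_monoid R\<lparr>carrier := S\<rparr>\<^esub> y)) = rat_class (q x) \<otimes>\<^bsub>rat_mod_int\<^esub> rat_class (q y)"
      by (simp add: rat_mod_int_mult rat_circle_eq_iff)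
  qed
  moreover have "rat_class (q x) = \<one>\<^bsub>rat_mod_int\<^esub> \<longleftrightarrow> \<chi> x = 1" if "x \<in> S" for x
    using q[OF that] by (simp add: rat_mod_int_one rat_class_eq_iff rat_circle_eq_1_iff)
  ultimately show ?thesis
    using that by blast
qed

text \<open>Only the socle matters: it is finite, hence so are the left ideals inside it, and every
  nonzero finite left ideal contains a minimal one, which belongs to the socle. \<open>E\<close> is
  arbitrary in order to cover both target groups.\<close>

lemma (in left_artinian_ring) finitarily_left_torsion_free_iff:
  "finitarily_left_torsion_free R E \<chi> \<longleftrightarrow>
    (\<forall>N. left_ideal N R \<longrightarrow> N \<subseteq> finitary_left_socle R \<longrightarrow> (\<forall>x\<in>N. \<chi> x = \<one>\<^bsub>E\<^esub>) \<longrightarrow> N = {\<zero>})"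
    (is "_ \<longleftrightarrow> ?R")
proof
  assume tf: "finitarily_left_torsion_free R E \<chi>"
  show ?R
  proof (intro allI impI)
    fix N assume N: "left_ideal N R" "N \<subseteq> finitary_left_socle R" "\<forall>x\<in>N. \<chi> x = \<one>\<^bsub>E\<^esub>"
    have "finite N"
      using finite_subset[OF N(2)] finite_semisimple_left_ideal[OF finite_semisimple_socle] by blast
    moreover have "N \<subseteq> kernel (add_monoid R) E \<chi>"
      using N(3) left_idealD(1)[OF N(1)] by (auto simp: kernel_def)
    ultimately show "N = {\<zero>}"
      using tf N(1) unfolding finitarily_left_torsion_free_def by blast
  qed
next
  assume tf: ?R
  show "finitarily_left_torsion_free R E \<chi>"
    unfolding finitarily_left_torsion_free_def
  proof clarify
    fix I assume I: "left_ideal I R" "finite I" "I \<noteq> {\<zero>}" "I \<subseteq> kernel (add_monoid R) E \<chi>"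
    obtain M where M: "minimal_left_ideal M R" "M \<subseteq> I"
      by (rule contains_minimal_left_ideal[OF I(1,3)])
    have "finite M"
      by (rule finite_subset[OF M(2) I(2)])
    then have "M \<subseteq> finitary_left_socle R"
      unfolding finitary_left_socle_def using M(1) by (auto intro: generate.incl)
    moreover have "\<forall>x\<in>M. \<chi> x = \<one>\<^bsub>E\<^esub>"
      using M(2) I(4) by (auto simp: kernel_def)
    ultimately show False
      using tf minimal_left_idealD(1,2)[OF M(1)] by blast
  qed
qed

theorem theorem2p6:
  fixes R :: "('a, 'b) ring_scheme"
  assumes "left_artinian_ring R"
  shows
    "(left_module_embeds R
        (left_ideal_module R (finitary_left_socle R))
        (left_quotient_module R (jacobson_radical R))
      \<longleftrightarrow> (\<exists>\<chi>\<in>hom (add_monoid R) rat_mod_int. finitarily_left_torsion_free R rat_mod_int \<chi>))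
   \<and> ((\<exists>\<chi>\<in>hom (add_monoid R) rat_mod_int. finitarily_left_torsion_free R rat_mod_int \<chi>)
      \<longleftrightarrow> (\<exists>\<chi>\<in>characters R. finitarily_left_torsion_free R circle_group \<chi>))"
proof -
  interpret left_artinian_ring R by (rule assms)
  let ?S = "finitary_left_socle R"
  have S: "left_ideal ?S R" "finite ?S"
    using finite_semisimple_left_ideal[OF finite_semisimple_socle] by auto
  \<comment> \<open>Torsion-free characters of the finite socle link the three conditions: their
    existence is equivalent to the embedding and yields a homomorphism into
    \<open>\<rat>/\<int>\<close>; this gives a character of \<open>R\<close>, whose restriction is
    again such a character.\<close>
  have "left_module_embeds R (left_ideal_module R ?S) (left_quotient_module R (jacobson_radical R))
      \<longleftrightarrow> (\<exists>\<chi>. torsion_free_character ?S \<chi>)"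
    using embeds_iff_cyclic[OF finite_semisimple_socle]
      cyclic_iff_torsion_free_character[OF finite_semisimple_socle] by simp
  moreover have "\<exists>\<phi>\<in>hom (add_monoid R) rat_mod_int. finitarily_left_torsion_free R rat_mod_int \<phi>"
    if chi: "torsion_free_character ?S \<chi>" for \<chi>
  proof -
    obtain \<phi> where phi: "\<phi> \<in> hom (add_monoid R\<lparr>carrier := ?S\<rparr>) rat_mod_int"
      and phi_one: "\<And>x. x \<in> ?S \<Longrightarrow> \<phi> x = \<one>\<^bsub>rat_mod_int\<^esub> \<longleftrightarrow> \<chi> x = 1"
      using character_lifts_to_rat_mod_int[OF S, of \<chi>] chi unfolding torsion_free_character_def by blast
    interpret comm_group_pair "add_monoid R" rat_mod_int
      by (intro comm_group_pair.intro a_comm_group comm_group_rat_mod_int)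
    have "subgroup ?S (add_monoid R)"
      using S(1) left_ideal.axioms(1) additive_subgroup.a_subgroup by blast
    then obtain g where g: "g \<in> hom (add_monoid R) rat_mod_int" "\<And>x. x \<in> ?S \<Longrightarrow> g x = \<phi> x"
      using hom_extends_to_divisible_group[OF rat_mod_int_divisible _ phi] by blast
    \<comment> \<open>Torsion-freeness depends only on the values on the socle, so any extension of
      \<open>\<phi>\<close> will do.\<close>
    have "finitarily_left_torsion_free R rat_mod_int g"
      unfolding finitarily_left_torsion_free_iff
    proof (intro allI impI)
      fix N assume N: "left_ideal N R" "N \<subseteq> ?S" "\<forall>x\<in>N. g x = \<one>\<^bsub>rat_mod_int\<^esub>"
      then have "\<forall>x\<in>N. \<chi> x = 1"
        using g(2) phi_one by (metis subsetD)
      then show "N = {\<zero>\<^bsub>R\<^esub>}"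
        using chi N unfolding torsion_free_character_def by blast
    qed
    then show ?thesis
      using g(1) by blast
  qed
  moreover have "\<exists>\<psi>\<in>characters R. finitarily_left_torsion_free R circle_group \<psi>"
    if phi: "\<phi> \<in> hom (add_monoid R) rat_mod_int" and tf: "finitarily_left_torsion_free R rat_mod_int \<phi>" for \<phi>
  proof -
    obtain \<iota> where iota: "\<iota> \<in> hom rat_mod_int circle_group"
      "\<And>c. c \<in> carrier rat_mod_int \<Longrightarrow> \<iota> c = 1 \<longleftrightarrow> c = \<one>\<^bsub>rat_mod_int\<^esub>"
      by (rule rat_mod_int_embeds_circle_group) blast
    have "\<iota> \<circ> \<phi> \<in> characters R"
      unfolding characters_def using hom_compose[OF phi iota(1)] .
    moreover have "finitarily_left_torsion_free R circle_group (\<iota> \<circ> \<phi>)"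
    proof -
      have "kernel (add_monoid R) circle_group (\<iota> \<circ> \<phi>) = kernel (add_monoid R) rat_mod_int \<phi>"
        using iota(2) hom_in_carrier[OF phi] by (auto simp: kernel_def circle_group_def)
      then show ?thesis
        using tf by (simp add: finitarily_left_torsion_free_def)
    qed
    ultimately show ?thesis by blast
  qed
  moreover have "\<exists>\<chi>. torsion_free_character ?S \<chi>"
    if psi: "\<psi> \<in> characters R" and tf: "finitarily_left_torsion_free R circle_group \<psi>" for \<psi>
  proof -
    have "restrict \<psi> ?S \<in> left_ideal_characters ?S"
      using psi left_idealD(1,3)[OF S(1)]
      by (intro left_ideal_charactersI) (auto simp: characters_def hom_def circle_group_def)
    moreover have "N = {\<zero>\<^bsub>R\<^esub>}" if N: "left_ideal N R" "N \<subseteq> ?S" "\<forall>x\<in>N. restrict \<psi> ?S x = 1" for N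
    proof -
      have "\<forall>x\<in>N. \<psi> x = \<one>\<^bsub>circle_group\<^esub>"
        using N(2,3) by (auto simp: circle_group_def subset_iff)
      then show ?thesis
        using tf N(1,2) unfolding finitarily_left_torsion_free_iff by blast
    qed
    ultimately show ?thesis
      unfolding torsion_free_character_def by blast
  qed
  ultimately show ?thesis
    by blast
qed

end
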